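(* Let $n>5$ be odd and let $R$ be an $(n+1)$-dimensional solvable complex Leibniz algebra whose nilradical is isomorphic to $g^1_{(n,1)}$. Then $R$ has a basis $\{e_1,\dots,e_n,x\}$ such that $\{e_1,\dots,e_n\}$ spans the nilradical with the brackets of $g^1_{(n,1)}$ (given in the context), and the brackets involving $x$ are of one of the following types (all brackets involving $x$ not listed, including $[x,x]$ unless listed, are zero; all parameters are complex): $R_1$ (parameters $a_2$ and $b_j$, $4\le j\le n-1$, with $b_{2k}=0$ for $2\le k\le\frac{n-3}{2}$): $[e_1,x]=-[x,e_1]=a_2e_2$; $[e_i,x]=-[x,e_i]=e_i+\sum_{t=i+2}^{n-1}b_{t-i+2}e_t$ for $2\le i\le n-2$; $[e_{n-1},x]=-[x,e_{n-1}]=e_{n-1}+a_2e_n$; $[e_n,x]=-[x,e_n]=2e_n$. $R_2(a_{n-1})$: $[e_1,x]=-[x,e_1]=e_1+a_{n-1}e_{n-1}$; $[e_i,x]=-[x,e_i]=(i+2-n)e_i$ for $2\le i\le n-1$; $[e_n,x]=-[x,e_n]=(4-n)e_n$. $R_3(\delta_{n-1})$: $[e_1,x]=-[x,e_1]=e_1$; $[e_i,x]=-[x,e_i]=(i+1-n)e_i$ for $2\le i\le n-2$; $[e_n,x]=-[x,e_n]=(2-n)e_n$; $[x,x]=\delta_{n-1}e_{n-1}$. $R_4(\delta_n)$: $[e_1,x]=-[x,e_1]=e_1$; $[e_i,x]=-[x,e_i]=(i-\frac n2)e_i$ for $2\le i\le n-1$; $[x,x]=\delta_ne_n$. $R_5(a_n)$: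 $[e_1,x]=-[x,e_1]=e_1+a_ne_n$; $[e_i,x]=-[x,e_i]=(i+\frac{1-n}{2})e_i$ for $2\le i\le n-1$; $[e_n,x]=-[x,e_n]=e_n$. $R_6(a_2)$: $[e_1,x]=-[x,e_1]=e_1+a_2e_2$; $[e_i,x]=-[x,e_i]=(i-1)e_i$ for $2\le i\le n-2$; $[e_{n-1},x]=-[x,e_{n-1}]=(n-2)e_{n-1}+a_2e_n$; $[e_n,x]=-[x,e_n]=(n-2)e_n$. $R_7(b_2)$, with $b_2\notin\{4-n,\,3-n,\,\frac{4-n}{2},\,\frac{5-n}{2},\,1\}$: $[e_1,x]=-[x,e_1]=e_1$; $[e_i,x]=-[x,e_i]=(i-2+b_2)e_i$ for $2\le i\le n-1$; $[e_n,x]=-[x,e_n]=(n-4+2b_2)e_n$.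
   Context: A Leibniz algebra is a complex vector space $L$ with a bilinear bracket satisfying $[u,[v,w]]=[[u,v],w]-[[u,w],v]$ for all $u,v,w$. Lower central series $L^1=L$, $L^{k+1}=[L^k,L]$; derived series $L^{[1]}=L$, $L^{[s+1]}=[L^{[s]},L^{[s]}]$; $L$ is nilpotent (resp. solvable) if some $L^k=0$ (resp. $L^{[s]}=0$). The nilradical is the maximal nilpotent (two-sided) ideal. The Lie algebra $g^1_{(n,1)}$ ($n$ odd) has basis $\{e_1,\dots,e_n\}$ with nonzero brackets $[e_1,e_i]=-[e_i,e_1]=e_{i+1}$ for $2\le i\le n-2$ and $[e_i,e_{n-i}]=-[e_{n-i},e_i]=(-1)^ie_n$ for $2\le i\le\frac{n-1}{2}$, all other brackets of basis elements being zero. *)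

theory Defs
  imports Complex_Main
begin

definition leibniz_algebra ::
  "(complex \<Rightarrow> 'a::ab_group_add \<Rightarrow> 'a) \<Rightarrow> ('a \<Rightarrow> 'a \<Rightarrow> 'a) \<Rightarrow> bool" where
  "leibniz_algebra scale br \<longleftrightarrow>
     vector_space scale \<and>
     (\<forall>x y z. br (x + y) z = br x z + br y z \<and> br z (x + y) = br z x + br z y) \<and>
     (\<forall>c x y. br (scale c x) y = scale c (br x y) \<and> br x (scale c y) = scale c (br x y)) \<and>
     (\<forall>u v w. br u (br v w) = br (br u v) w - br (br u w) v)"

definition brset ::
  "(complex \<Rightarrow> 'a::ab_group_add \<Rightarrow> 'a) \<Rightarrow> ('a \<Rightarrow> 'a \<Rightarrow> 'a) \<Rightarrow> 'a set \<Rightarrow> 'a set \<Rightarrow> 'a set" where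
  "brset scale br A B = module.span scale {br a b | a b. a \<in> A \<and> b \<in> B}"

fun lcs ::
  "(complex \<Rightarrow> 'a::ab_group_add \<Rightarrow> 'a) \<Rightarrow> ('a \<Rightarrow> 'a \<Rightarrow> 'a) \<Rightarrow> 'a set \<Rightarrow> nat \<Rightarrow> 'a set" where
  "lcs scale br I 0 = I"
| "lcs scale br I (Suc k) = brset scale br (lcs scale br I k) I"

fun der ::
  "(complex \<Rightarrow> 'a::ab_group_add \<Rightarrow> 'a) \<Rightarrow> ('a \<Rightarrow> 'a \<Rightarrow> 'a) \<Rightarrow> 'a set \<Rightarrow> nat \<Rightarrow> 'a set" where
  "der scale br I 0 = I"
| "der scale br I (Suc s) = brset scale br (der scale br I s) (der scale br I s)"

definition nilpotent_set ::
  "(complex \<Rightarrow> 'a::ab_group_add \<Rightarrow> 'a) \<Rightarrow> ('a \<Rightarrow> 'a \<Rightarrow> 'a) \<Rightarrow> 'a set \<Rightarrow> bool" where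
  "nilpotent_set scale br I \<longleftrightarrow> (\<exists>k. lcs scale br I k = {0})"

definition solvable_alg ::
  "(complex \<Rightarrow> 'a::ab_group_add \<Rightarrow> 'a) \<Rightarrow> ('a \<Rightarrow> 'a \<Rightarrow> 'a) \<Rightarrow> bool" where
  "solvable_alg scale br \<longleftrightarrow> (\<exists>s. der scale br UNIV s = {0})"

definition lideal ::
  "(complex \<Rightarrow> 'a::ab_group_add \<Rightarrow> 'a) \<Rightarrow> ('a \<Rightarrow> 'a \<Rightarrow> 'a) \<Rightarrow> 'a set \<Rightarrow> bool" where
  "lideal scale br I \<longleftrightarrow> module.subspace scale I \<and>
     (\<forall>a\<in>I. \<forall>y. br a y \<in> I \<and> br y a \<in> I)"

definition is_nilradical ::
  "(complex \<Rightarrow> 'a::ab_group_add \<Rightarrow> 'a) \<Rightarrow> ('a \<Rightarrow> 'a \<Rightarrow> 'a) \<Rightarrow> 'a set \<Rightarrow> bool" where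
  "is_nilradical scale br N \<longleftrightarrow> lideal scale br N \<and> nilpotent_set scale br N \<and>
     (\<forall>M. lideal scale br M \<and> nilpotent_set scale br M \<and> N \<subseteq> M \<longrightarrow> M = N)"

text \<open>Structure constants of g^1_(n,1): coefficient of e_k in [e_i,e_j].\<close>
definition gcoef :: "nat \<Rightarrow> nat \<Rightarrow> nat \<Rightarrow> nat \<Rightarrow> complex" where
  "gcoef n i j k =
     (if i = 1 \<and> 2 \<le> j \<and> j \<le> n - 2 \<and> k = j + 1 then 1
      else if j = 1 \<and> 2 \<le> i \<and> i \<le> n - 2 \<and> k = i + 1 then -1
      else if 2 \<le> i \<and> i \<le> (n - 1) div 2 \<and> j = n - i \<and> k = n then (-1) ^ i
      else if 2 \<le> j \<and> j \<le> (n - 1) div 2 \<and> i = n - j \<and> k = n then - ((-1) ^ j)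
      else 0)"

definition lincomb ::
  "(complex \<Rightarrow> 'a::ab_group_add \<Rightarrow> 'a) \<Rightarrow> nat \<Rightarrow> (nat \<Rightarrow> 'a) \<Rightarrow> (nat \<Rightarrow> complex) \<Rightarrow> 'a" where
  "lincomb scale n e c = (\<Sum>k\<in>{1..n}. scale (c k) (e k))"

text \<open>e_1..e_n is a basis of N realising the brackets of g^1_(n,1);
  the existence of such e is exactly an isomorphism N \<cong> g^1_(n,1).\<close>
definition g1_basis ::
  "(complex \<Rightarrow> 'a::ab_group_add \<Rightarrow> 'a) \<Rightarrow> ('a \<Rightarrow> 'a \<Rightarrow> 'a) \<Rightarrow> nat \<Rightarrow> (nat \<Rightarrow> 'a) \<Rightarrow> 'a set \<Rightarrow> bool" where
  "g1_basis scale br n e N \<longleftrightarrow>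
     inj_on e {1..n} \<and> \<not> module.dependent scale (e ` {1..n}) \<and>
     module.span scale (e ` {1..n}) = N \<and>
     (\<forall>i\<in>{1..n}. \<forall>j\<in>{1..n}. br (e i) (e j) = lincomb scale n e (gcoef n i j))"

definition x_brackets ::
  "(complex \<Rightarrow> 'a::ab_group_add \<Rightarrow> 'a) \<Rightarrow> ('a \<Rightarrow> 'a \<Rightarrow> 'a) \<Rightarrow> nat \<Rightarrow> (nat \<Rightarrow> 'a) \<Rightarrow> 'a
     \<Rightarrow> (nat \<Rightarrow> nat \<Rightarrow> complex) \<Rightarrow> (nat \<Rightarrow> complex) \<Rightarrow> bool" where
  "x_brackets scale br n e x c d \<longleftrightarrow>
     (\<forall>i\<in>{1..n}. br (e i) x = lincomb scale n e (c i) \<and> br x (e i) = - lincomb scale n e (c i)) \<and>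
     br x x = lincomb scale n e d"

text \<open>Coefficient tables of the seven families (c i k = coefficient of e_k in [e_i,x]).\<close>

definition R1c :: "nat \<Rightarrow> complex \<Rightarrow> (nat \<Rightarrow> complex) \<Rightarrow> nat \<Rightarrow> nat \<Rightarrow> complex" where
  "R1c n a2 b i k =
     (if i = 1 then (if k = 2 then a2 else 0)
      else if 2 \<le> i \<and> i \<le> n - 2 then
        (if k = i then 1 else if i + 2 \<le> k \<and> k \<le> n - 1 then b (k - i + 2) else 0)
      else if i = n - 1 then (if k = n - 1 then 1 else if k = n then a2 else 0)
      else if i = n then (if k = n then 2 else 0)
      else 0)"

definition R2c :: "nat \<Rightarrow> complex \<Rightarrow> nat \<Rightarrow> nat \<Rightarrow> complex" where
  "R2c n a i k =
     (if i = 1 then (if k = 1 then 1 else if k = n - 1 then a else 0)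
      else if 2 \<le> i \<and> i \<le> n - 1 then (if k = i then of_nat i + 2 - of_nat n else 0)
      else if i = n then (if k = n then 4 - of_nat n else 0)
      else 0)"

definition R3c :: "nat \<Rightarrow> nat \<Rightarrow> nat \<Rightarrow> complex" where
  "R3c n i k =
     (if i = 1 then (if k = 1 then 1 else 0)
      else if 2 \<le> i \<and> i \<le> n - 2 then (if k = i then of_nat i + 1 - of_nat n else 0)
      else if i = n then (if k = n then 2 - of_nat n else 0)
      else 0)"

definition R4c :: "nat \<Rightarrow> nat \<Rightarrow> nat \<Rightarrow> complex" where
  "R4c n i k =
     (if i = 1 then (if k = 1 then 1 else 0)
      else if 2 \<le> i \<and> i \<le> n - 1 then (if k = i then of_nat i - of_nat n / 2 else 0)
      else 0)"

definition R5c :: "nat \<Rightarrow> complex \<Rightarrow> nat \<Rightarrow> nat \<Rightarrow> complex" where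
  "R5c n a i k =
     (if i = 1 then (if k = 1 then 1 else if k = n then a else 0)
      else if 2 \<le> i \<and> i \<le> n - 1 then (if k = i then of_nat i + (1 - of_nat n) / 2 else 0)
      else if i = n then (if k = n then 1 else 0)
      else 0)"

definition R6c :: "nat \<Rightarrow> complex \<Rightarrow> nat \<Rightarrow> nat \<Rightarrow> complex" where
  "R6c n a2 i k =
     (if i = 1 then (if k = 1 then 1 else if k = 2 then a2 else 0)
      else if 2 \<le> i \<and> i \<le> n - 2 then (if k = i then of_nat i - 1 else 0)
      else if i = n - 1 then (if k = n - 1 then of_nat n - 2 else if k = n then a2 else 0)
      else if i = n then (if k = n then of_nat n - 2 else 0)
      else 0)"

definition R7c :: "nat \<Rightarrow> complex \<Rightarrow> nat \<Rightarrow> nat \<Rightarrow> complex" where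
  "R7c n b2 i k =
     (if i = 1 then (if k = 1 then 1 else 0)
      else if 2 \<le> i \<and> i \<le> n - 1 then (if k = i then of_nat i - 2 + b2 else 0)
      else if i = n then (if k = n then of_nat n - 4 + 2 * b2 else 0)
      else 0)"

end

theory Submission
  imports Defs
begin

text \<open>Write \<open>V m\<close> for the span of \<open>e\<^sub>m, \<dots>, e\<^sub>n\<close>. Right multiplication by an element \<open>x\<close> outside the
  nilradical \<open>N\<close> is a derivation of \<open>N\<close>, and \<open>[e\<^sub>2, e\<^sub>3] = 0\<close> forces it to be triangular in the given
  basis, with diagonal entries \<open>\<alpha>\<close>, \<open>(i - 2) \<alpha> + \<beta>\<close> for \<open>2 \<le> i < n\<close>, and \<open>(n - 4) \<alpha> + 2 \<beta>\<close>. If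
  \<open>\<alpha> = \<beta> = 0\<close> the whole algebra is nilpotent, which contradicts the maximality of \<open>N\<close>; otherwise the
  central elements \<open>[v, x] + [x, v]\<close> have to vanish, so only \<open>[x, x]\<close> can keep \<open>R\<close> from being a Lie
  algebra.

  If \<open>\<alpha> \<noteq> 0\<close>, scale it to \<open>1\<close>. The entries \<open>(i - 2) + \<beta>\<close> are pairwise distinct, so up to resonances
  between equal weights there are eigenvectors \<open>f\<^sub>1\<close> and \<open>f\<^sub>2\<close>; iterating \<open>[f\<^sub>1, \<cdot>]\<close> on \<open>f\<^sub>2\<close> gives further
  eigenvectors, and comparing weights shows that they satisfy the relations of the nilradical again. The
  exceptional values of \<open>\<beta>\<close> are those at which a resonance occurs or \<open>[x, x]\<close> may be nonzero. If
  \<open>\<alpha> = 0\<close>, scale \<open>\<beta>\<close> to \<open>1\<close>; only multiples of \<open>e\<^sub>n\<close> have to be added to \<open>e\<^sub>1\<close> and \<open>e\<^sub>2\<close>, and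
  \<open>[e\<^sub>2, e\<^sub>j] = 0\<close> forces the coefficients with even index to vanish.\<close>

section \<open>Leibniz algebras\<close>

declare One_nat_def [simp del]

locale leibniz = vector_space scale
  for scale :: "complex \<Rightarrow> 'a::ab_group_add \<Rightarrow> 'a" (infixr "*s" 75) +
  fixes br :: "'a \<Rightarrow> 'a \<Rightarrow> 'a"
  assumes br_add_left: "br (x + y) z = br x z + br y z"
    and br_add_right: "br z (x + y) = br z x + br z y"
    and br_scale_left: "br (c *s x) y = c *s br x y"
    and br_scale_right: "br x (c *s y) = c *s br x y"
    and leibniz: "br u (br v w) = br (br u v) w - br (br u w) v"
begin

lemma eq_neg_self_imp_zero:
  fixes y :: 'a
  assumes "y = - y"
  shows "y = 0"
proof -
  have "y + y = 0"
    using assms by (metis add.right_inverse)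
  then have "2 *s y = 0"
    by (metis one_add_one scale_left_distrib scale_one)
  then show ?thesis by simp
qed

lemma br_zero_left [simp]: "br 0 y = 0"
  using br_scale_left[of 0 0 y] by simp

lemma br_zero_right [simp]: "br y 0 = 0"
  using br_scale_right[of y 0 0] by simp

lemma br_minus_left: "br (- x) y = - br x y"
  by (metis br_scale_left scale_minus_left scale_one)

lemma br_minus_right: "br x (- y) = - br x y"
  by (metis br_scale_right scale_minus_left scale_one)

lemma br_diff_left: "br (x - y) z = br x z - br y z"
  using br_add_left[of x "- y" z] by (simp add: br_minus_left)

lemma br_diff_right: "br z (x - y) = br z x - br z y"
  using br_add_right[of z x "- y"] by (simp add: br_minus_right)

lemmas br_linear = br_add_left br_add_right br_diff_left br_diff_right
  br_minus_left br_minus_right br_scale_left br_scale_right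

lemma br_sum_left: "br (\<Sum>i\<in>A. h i) y = (\<Sum>i\<in>A. br (h i) y)"
  by (induction A rule: infinite_finite_induct) (auto simp: br_add_left)

lemma br_sum_right: "br y (\<Sum>i\<in>A. h i) = (\<Sum>i\<in>A. br y (h i))"
  by (induction A rule: infinite_finite_induct) (auto simp: br_add_right)

lemma br_left_in_subspace:
  assumes "u \<in> span S" "subspace W" "\<And>s. s \<in> S \<Longrightarrow> br s y \<in> W"
  shows "br u y \<in> W"
  using assms(1)
proof (induction rule: span_induct_alt)
  case base
  then show ?case using assms(2) by (simp add: subspace_0)
next
  case (step c s u)
  then show ?case
    using assms by (simp add: br_add_left br_scale_left subspace_add subspace_scale)
qed

lemma br_right_in_subspace:
  assumes "u \<in> span S" "subspace W" "\<And>s. s \<in> S \<Longrightarrow> br y s \<in> W"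
  shows "br y u \<in> W"
  using assms(1)
proof (induction rule: span_induct_alt)
  case base
  then show ?case using assms(2) by (simp add: subspace_0)
next
  case (step c s u)
  then show ?case
    using assms by (simp add: br_add_right br_scale_right subspace_add subspace_scale)
qed

text \<open>The Leibniz identity solved for its first term on the right: a product rule for right
  multiplication only. All weight computations rest on it.\<close>

lemma right_mult_derivation: "br (br u v) x = br u (br v x) + br (br u x) v"
  by (simp add: leibniz)

lemma br_square_right [simp]: "br u (br x x) = 0"
  by (simp add: leibniz)

text \<open>The right-hand side of the Leibniz identity is skew in \<open>v\<close> and
  \<open>w\<close>, so symmetrised products annihilate everything from the right. They measure the
  failure of being a Lie algebra.\<close>

lemma br_anticommutator_right [simp]: "br u (br v w + br w v) = 0"
  by (simp add: br_add_right leibniz)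

text \<open>By induction the filtration contains the lower central series. Right multiplications
  suffice because \<open>lcs\<close> brackets with the whole algebra on the right.\<close>

lemma nilpotent_if_filtration:
  assumes "\<And>y. y \<in> F 0" "\<And>i. subspace (F i)" "\<And>i u y. u \<in> F i \<Longrightarrow> br u y \<in> F (Suc i)"
    and "F k = {0}"
  shows "nilpotent_set scale br UNIV"
proof -
  have sub: "lcs scale br UNIV i \<subseteq> F i" for i
  proof (induction i)
    case 0
    then show ?case using assms(1) by auto
  next
    case (Suc i)
    have "{br a b | a b. a \<in> lcs scale br UNIV i \<and> b \<in> UNIV} \<subseteq> F (Suc i)"
      using Suc assms(3) by blast
    then show ?case
      using assms(2) by (simp add: brset_def span_minimal)
  qed
  have "0 \<in> lcs scale br UNIV i" for i
    by (cases i) (auto simp: brset_def span_zero)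
  then have "lcs scale br UNIV k = {0}"
    using sub[of k] assms(4) by auto
  then show ?thesis
    unfolding nilpotent_set_def by blast
qed

lemma lincomb_zero: "lincomb scale n e (\<lambda>k. 0) = 0"
  by (simp add: lincomb_def)

lemma lincomb_single:
  assumes "\<And>k. k \<in> {1..n} \<Longrightarrow> c k = (if k = i then \<alpha> else 0)" "i \<in> {1..n}"
  shows "lincomb scale n e c = \<alpha> *s e i"
proof -
  have "lincomb scale n e c = (\<Sum>k\<in>{1..n}. if k = i then \<alpha> *s e i else 0)"
    unfolding lincomb_def using assms(1) by (intro sum.cong) auto
  then show ?thesis using assms(2) by simp
qed

lemma lincomb_double:
  assumes "\<And>k. k \<in> {1..n} \<Longrightarrow> c k = (if k = i then \<alpha> else if k = j then \<beta> else 0)"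
    and "i \<in> {1..n}" "j \<in> {1..n}" "i \<noteq> j"
  shows "lincomb scale n e c = \<alpha> *s e i + \<beta> *s e j"
proof -
  have "lincomb scale n e c =
      (\<Sum>k\<in>{1..n}. (if k = i then \<alpha> *s e i else 0) + (if k = j then \<beta> *s e j else 0))"
    unfolding lincomb_def using assms(1,4) by (intro sum.cong) auto
  then show ?thesis using assms(2,3) by (simp add: sum.distrib)
qed

text \<open>Replaces the case table \<open>gcoef\<close> by rules that can be checked by
  calculation. Skew symmetry supplies the products with \<open>e 1\<close> on the right. One sign
  formula serves both orders in the pairing, because for odd \<open>n\<close> the indices
  \<open>i\<close> and \<open>n - i\<close> have opposite parity.\<close>

lemma g1_basisI:
  assumes "odd n" "n > 5"
    and "inj_on e {1..n}" "independent (e ` {1..n})" "span (e ` {1..n}) = N"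
    and skew: "\<And>i j. i \<in> {1..n} \<Longrightarrow> j \<in> {1..n} \<Longrightarrow> br (e j) (e i) = - br (e i) (e j)"
    and e1: "\<And>i. 2 \<le> i \<Longrightarrow> i \<le> n - 2 \<Longrightarrow> br (e 1) (e i) = e (i + 1)"
    and top: "br (e 1) (e (n - 1)) = 0" "br (e 1) (e n) = 0"
    and tail: "\<And>i j. i \<in> {2..n} \<Longrightarrow> j \<in> {2..n} \<Longrightarrow>
      br (e i) (e j) = (if i + j = n then (- 1) ^ i *s e n else 0)"
  shows "g1_basis scale br n e N"
proof -
  have "br (e i) (e j) = lincomb scale n e (gcoef n i j)" if ij: "i \<in> {1..n}" "j \<in> {1..n}" for i j
  proof -
    have sq: "br (e 1) (e 1) = 0"
      using skew[of 1 1] \<open>n > 5\<close> by (intro eq_neg_self_imp_zero) auto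
    have e1': "br (e 1) (e i) = lincomb scale n e (gcoef n 1 i)"
        "br (e i) (e 1) = lincomb scale n e (gcoef n i 1)" if "i \<in> {1..n}" for i
    proof -
      have "i = 1 \<or> 2 \<le> i \<and> i \<le> n - 2 \<or> i = n - 1 \<or> i = n"
        using that unfolding atLeastAtMost_iff by presburger
      then consider "i = 1" | "2 \<le> i" "i \<le> n - 2" | "i = n - 1" | "i = n"
        by blast
      then have "br (e 1) (e i) = lincomb scale n e (gcoef n 1 i) \<and>
        br (e i) (e 1) = lincomb scale n e (gcoef n i 1)"
      proof cases
        case 2
        have "lincomb scale n e (gcoef n 1 i) = 1 *s e (i + 1)"
          using 2 \<open>n > 5\<close> by (intro lincomb_single) (auto simp: gcoef_def)
        moreover have "lincomb scale n e (gcoef n i 1) = (- 1) *s e (i + 1)"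
          using 2 \<open>n > 5\<close> by (intro lincomb_single) (auto simp: gcoef_def)
        ultimately show ?thesis
          using e1[OF 2] skew[of 1 i] 2 \<open>n > 5\<close> by simp
      qed (use \<open>n > 5\<close> sq top skew[of 1 "n - 1"] skew[of 1 n] in
          \<open>auto simp: lincomb_def gcoef_def intro!: sum.neutral\<close>)
      then show "br (e 1) (e i) = lincomb scale n e (gcoef n 1 i)"
        "br (e i) (e 1) = lincomb scale n e (gcoef n i 1)" by auto
    qed
    consider "i = 1" | "j = 1" | "2 \<le> i" "2 \<le> j" "i + j \<noteq> n" | "2 \<le> i" "2 \<le> j" "i + j = n"
      using ij unfolding atLeastAtMost_iff by linarith
    then show ?thesis
    proof cases
      case 3
      then have "lincomb scale n e (gcoef n i j) = 0"
        using ij by (auto simp: lincomb_def gcoef_def intro!: sum.neutral)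
      then show ?thesis using tail[of i j] 3 ij by simp
    next
      case 4
      have j: "j = n - i" "i = n - j" using 4 by auto
      have par: "(- 1 :: complex) ^ i = - ((- 1) ^ j)"
      proof -
        have "even i \<longleftrightarrow> odd j" using 4 \<open>odd n\<close> by presburger
        then show ?thesis by (cases "even i") auto
      qed
      \<comment> \<open>Exactly one of \<open>i\<close> and \<open>j\<close> is at most
        \<open>(n - 1) div 2\<close>, so exactly one of the two pairing branches of
        \<open>gcoef\<close> applies.\<close>
      obtain m where "n = 2 * m + 1" using \<open>odd n\<close> by (rule oddE)
      then have "i \<le> (n - 1) div 2 \<longleftrightarrow> \<not> j \<le> (n - 1) div 2"
        using 4 by auto
      then have "lincomb scale n e (gcoef n i j) = (- 1) ^ i *s e n"
        using 4 ij par by (intro lincomb_single) (auto simp: gcoef_def)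
      then show ?thesis using tail[of i j] 4 ij by simp
    qed (use e1' ij in auto)
  qed
  then show ?thesis
    unfolding g1_basis_def using assms(3-5) by blast
qed

end

section \<open>The brackets of the nilradical\<close>

locale g1_frame = leibniz scale br
  for scale :: "complex \<Rightarrow> 'a::ab_group_add \<Rightarrow> 'a" (infixr "*s" 75)
    and br :: "'a \<Rightarrow> 'a \<Rightarrow> 'a" +
  fixes n :: nat and e :: "nat \<Rightarrow> 'a" and N :: "'a set"
  assumes n_odd: "odd n" and n_gt: "n > 5" and frame: "g1_basis scale br n e N"
begin

definition V :: "nat \<Rightarrow> 'a set" where
  "V m = span (e ` {m..n})"

lemma n_ge: "n \<ge> 7"
  using n_odd n_gt by presburger

lemma indep: "independent (e ` {1..n})"
  and inj: "inj_on e {1..n}"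
  and V_one: "V 1 = N"
  using frame by (auto simp: g1_basis_def V_def)

lemma subspace_V [simp]: "subspace (V m)"
  by (simp add: V_def)

lemma e_in_V [simp]: "m \<le> i \<Longrightarrow> i \<le> n \<Longrightarrow> e i \<in> V m"
  by (simp add: V_def span_base)

lemma V_mono: "m \<le> m' \<Longrightarrow> u \<in> V m' \<Longrightarrow> u \<in> V m"
  unfolding V_def using span_mono[of "e ` {m'..n}" "e ` {m..n}"] by fastforce

lemma V_empty: "V (Suc n) = {0}"
  by (simp add: V_def)

lemmas V_closed = subspace_add[OF subspace_V] subspace_diff[OF subspace_V]
  subspace_scale[OF subspace_V] subspace_neg[OF subspace_V] subspace_0[OF subspace_V]

lemma V_in_N: "1 \<le> m \<Longrightarrow> u \<in> V m \<Longrightarrow> u \<in> N"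
  using V_mono V_one by blast

lemma V_split:
  assumes "u \<in> V m" "m \<le> n"
  obtains c v where "v \<in> V (Suc m)" "u = c *s e m + v"
proof -
  have "{m..n} = insert m {Suc m..n}" using assms(2) by auto
  then have "u \<in> span (insert (e m) (e ` {Suc m..n}))"
    using assms(1) by (simp add: V_def)
  then obtain c where "u - c *s e m \<in> V (Suc m)"
    unfolding span_breakdown_eq V_def by blast
  then show ?thesis
    by (intro that[of "u - c *s e m" c]) auto
qed

text \<open>Linear independence in the form used for comparing leading coefficients modulo later
  basis vectors.\<close>

lemma V_coeff_zero:
  assumes "c *s e i \<in> V (Suc i)" "1 \<le> i" "i \<le> n"
  shows "c = 0"
proof (rule ccontr)
  assume "c \<noteq> 0"
  then have "e i \<in> V (Suc i)"
    using V_closed(3)[OF assms(1), of "1 / c"] by simp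
  moreover have "e j \<noteq> e i" if "j \<in> {Suc i..n}" for j
    using inj_onD[OF inj, of j i] that assms(2,3) by auto
  then have "e ` {Suc i..n} \<subseteq> e ` {1..n} - {e i}"
    by auto
  ultimately have "e i \<in> span (e ` {1..n} - {e i})"
    unfolding V_def using span_mono by blast
  then show False
    using indep assms(2,3) by (auto simp: dependent_def)
qed

lemma V_top:
  assumes "u \<in> V n"
  obtains c where "u = c *s e n"
  using V_split[OF assms] V_empty by auto

lemma e_nonzero: "1 \<le> i \<Longrightarrow> i \<le> n \<Longrightarrow> e i \<noteq> 0"
  using V_coeff_zero[of 1 i] V_closed(5) by auto

lemma br_table: "i \<in> {1..n} \<Longrightarrow> j \<in> {1..n} \<Longrightarrow> br (e i) (e j) = lincomb scale n e (gcoef n i j)"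
  using frame by (simp add: g1_basis_def)

lemma br_e1_e1 [simp]: "br (e 1) (e 1) = 0"
  using n_gt by (auto simp: br_table lincomb_def gcoef_def intro!: sum.neutral)

lemma br_e1_e:
  assumes "2 \<le> i" "i \<le> n - 2"
  shows "br (e 1) (e i) = e (Suc i)"
proof -
  have "lincomb scale n e (gcoef n 1 i) = 1 *s e (Suc i)"
    using assms n_gt by (intro lincomb_single) (auto simp: gcoef_def)
  then show ?thesis using assms br_table[of 1 i] by simp
qed

lemma br_e_e1:
  assumes "2 \<le> i" "i \<le> n - 2"
  shows "br (e i) (e 1) = - e (Suc i)"
proof -
  have "lincomb scale n e (gcoef n i 1) = (- 1) *s e (Suc i)"
    using assms n_gt by (intro lincomb_single) (auto simp: gcoef_def)
  then show ?thesis using assms br_table[of i 1] by simp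
qed

lemma br_e_e:
  assumes "2 \<le> i" "i \<le> n" "2 \<le> j" "j \<le> n"
  shows "br (e i) (e j) = (if i + j = n then (- 1) ^ i *s e n else 0)"
proof (cases "i + j = n")
  case True
  have j: "j = n - i" "i = n - j" using True by auto
  have par: "(- 1 :: complex) ^ i = - ((- 1) ^ j)"
  proof -
    have "even i \<longleftrightarrow> odd j" using True n_odd by presburger
    then show ?thesis by (cases "even i") auto
  qed
  obtain m where "n = 2 * m + 1" using n_odd by (rule oddE)
  then have "i \<le> (n - 1) div 2 \<longleftrightarrow> \<not> j \<le> (n - 1) div 2"
    using True by auto
  then have "gcoef n i j k = (if k = n then (- 1) ^ i else 0)" for k
    using True assms par by (cases "i \<le> (n - 1) div 2") (simp_all add: gcoef_def j(1)[symmetric] j(2)[symmetric])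
  then have "lincomb scale n e (gcoef n i j) = (- 1) ^ i *s e n"
    using n_gt by (intro lincomb_single) auto
  then show ?thesis using True assms by (simp add: br_table)
next
  case False
  then have "lincomb scale n e (gcoef n i j) = 0"
    using assms by (auto simp: lincomb_def gcoef_def intro!: sum.neutral)
  then show ?thesis using False assms by (simp add: br_table)
qed

lemma br_e1_top: "i \<in> {n - 1, n} \<Longrightarrow> br (e 1) (e i) = 0 \<and> br (e i) (e 1) = 0"
  using n_gt by (auto simp: br_table lincomb_def gcoef_def intro!: sum.neutral)

lemma br_e_skew:
  assumes "i \<in> {1..n}" "j \<in> {1..n}"
  shows "br (e i) (e j) = - br (e j) (e i)"
proof -
  have 1: "br (e i) (e 1) = - br (e 1) (e i)" if "i \<in> {1..n}" for i
  proof -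
    have "i = 1 \<or> 2 \<le> i \<and> i \<le> n - 2 \<or> i \<in> {n - 1, n}"
      using that by auto
    then show ?thesis
      using br_e1_e br_e_e1 br_e1_top by auto
  qed
  consider "i = 1" | "j = 1" | "2 \<le> i" "2 \<le> j"
    using assms unfolding atLeastAtMost_iff by linarith
  then show ?thesis
  proof cases
    case 3
    have "i + j = n \<Longrightarrow> even i \<longleftrightarrow> odd j" using n_odd by presburger
    then have "i + j = n \<Longrightarrow> (- 1 :: complex) ^ i = - ((- 1) ^ j)"
      by (cases "even i") auto
    then show ?thesis
      using 3 assms by (auto simp: br_e_e add.commute)
  qed (use 1[of i] 1[of j] assms in auto)
qed

lemma br_skew:
  assumes "u \<in> N" "v \<in> N"
  shows "br u v = - br v u"
proof -
  have "br (e i) v + br v (e i) \<in> {0}" if "i \<in> {1..n}" for i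
  proof -
    have "v \<in> span (e ` {1..n})" using assms(2) V_one by (simp add: V_def)
    then show ?thesis
    proof (induction rule: span_induct_alt)
      case (step c s v)
      then have "br (e i) s + br s (e i) = 0"
        using br_e_skew that by (metis imageE neg_eq_iff_add_eq_0)
      moreover have "br (e i) (c *s s + v) + br (c *s s + v) (e i) =
          c *s (br (e i) s + br s (e i)) + (br (e i) v + br v (e i))"
        by (simp add: br_linear scale_right_distrib)
      ultimately show ?case using step by simp
    qed simp
  qed
  then have e: "br s v + br v s = 0" if "s \<in> e ` {1..n}" for s
    using that by auto
  have "u \<in> span (e ` {1..n})" using assms(1) V_one by (simp add: V_def)
  then have "br u v + br v u = 0"
  proof (induction rule: span_induct_alt)
    case (step c s u)
    have "br (c *s s + u) v + br v (c *s s + u) =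
        c *s (br s v + br v s) + (br u v + br v u)"
      by (simp add: br_linear scale_right_distrib)
    then show ?case using step e[of s] by simp
  qed simp
  then show ?thesis by (simp add: eq_neg_iff_add_eq_0)
qed

lemma br_e1_V:
  assumes "u \<in> V i" "2 \<le> i"
  shows "br (e 1) u \<in> V (Suc i)"
proof (rule br_right_in_subspace[of u "e ` {i..n}"])
  fix s assume "s \<in> e ` {i..n}"
  then obtain j where j: "s = e j" "i \<le> j" "j \<le> n" by auto
  show "br (e 1) s \<in> V (Suc i)"
  proof (cases "j \<le> n - 2")
    case True
    then have "Suc j \<le> n" using n_gt by linarith
    then show ?thesis using j assms True by (auto simp: br_e1_e)
  next
    case False
    then have "j \<in> {n - 1, n}" using j by auto
    then show ?thesis using j br_e1_top V_closed(5) by auto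
  qed
qed (use assms in \<open>auto simp: V_def\<close>)

text \<open>Products of vectors in \<open>V 2\<close> are multiples of \<open>e n\<close>, and they
  can be nonzero only if the indices can add up to \<open>n\<close>. The target \<open>W\<close> is
  left open so that \<open>V n\<close>, \<open>{0}\<close> and deeper members of the flag are all
  covered.\<close>

lemma br_V_V_in:
  assumes "u \<in> V i" "v \<in> V j" "2 \<le> i" "2 \<le> j" "subspace W" "i + j \<le> n \<Longrightarrow> e n \<in> W"
  shows "br u v \<in> W"
proof (rule br_left_in_subspace[of u "e ` {i..n}"])
  fix s assume s: "s \<in> e ` {i..n}"
  show "br s v \<in> W"
  proof (rule br_right_in_subspace[of v "e ` {j..n}"])
    fix t assume "t \<in> e ` {j..n}"
    then show "br s t \<in> W"
      using s assms by (auto simp: br_e_e subspace_0 intro!: subspace_scale)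
  qed (use assms in \<open>auto simp: V_def\<close>)
qed (use assms in \<open>auto simp: V_def\<close>)

lemma br_V_V: "u \<in> V 2 \<Longrightarrow> v \<in> V 2 \<Longrightarrow> br u v \<in> V n"
  by (rule br_V_V_in[of u 2 v 2]) auto

lemma br_V_V_zero: "u \<in> V i \<Longrightarrow> v \<in> V j \<Longrightarrow> 2 \<le> i \<Longrightarrow> 2 \<le> j \<Longrightarrow> n < i + j \<Longrightarrow> br u v = 0"
  using br_V_V_in[of u i v j "{0}"] by auto

lemma N_split:
  assumes "u \<in> N"
  obtains c v where "v \<in> V 2" "u = c *s e 1 + v"
proof -
  have "u \<in> V 1" "1 \<le> n" using assms V_one n_gt by auto
  then obtain c v where "v \<in> V (Suc 1)" "u = c *s e 1 + v"
    by (rule V_split)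
  then show ?thesis using that[of v c] by (simp add: Suc_1)
qed

text \<open>The bracket with \<open>e 1\<close> kills the last two basis vectors, and the pairing
  with \<open>V 2\<close> cannot reach \<open>e n\<close>, since
  \<open>2 + (n - 1) > n\<close>.\<close>

lemma center_left:
  assumes "u \<in> V (n - 1)" "v \<in> N"
  shows "br v u = 0"
proof -
  obtain c w where w: "w \<in> V 2" "v = c *s e 1 + w"
    using assms(2) N_split by blast
  have "br (e 1) u \<in> {0}"
  proof (rule br_right_in_subspace[of u "e ` {n - 1..n}"])
    fix s assume "s \<in> e ` {n - 1..n}"
    then obtain j where "s = e j" "n - 1 \<le> j" "j \<le> n" by auto
    moreover from this have "j \<in> {n - 1, n}" by auto
    ultimately show "br (e 1) s \<in> {0}" using br_e1_top by auto
  qed (use assms in \<open>auto simp: V_def\<close>)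
  moreover have "br w u = 0"
    using w(1) assms(1) n_gt by (intro br_V_V_zero[of w 2 u "n - 1"]) auto
  ultimately show ?thesis by (simp add: w br_linear)
qed

lemma center_right:
  assumes "u \<in> V (n - 1)" "v \<in> N"
  shows "br u v = 0"
proof -
  have "u \<in> N" using assms n_gt by (intro V_in_N[of "n - 1"]) auto
  then show ?thesis using br_skew[of u v] assms center_left[OF assms] by simp
qed

text \<open>Bracketing with \<open>e 2\<close> turns the coefficient of \<open>e 1\<close> into one
  of \<open>e 3\<close>, which must vanish. After that the pairing of \<open>e (n - m)\<close> with
  \<open>e m\<close> removes the coefficients of \<open>e m\<close> for
  \<open>m = 2, ..., n - 2\<close> in increasing order. This locates squares and symmetrised
  products, which are annihilated from the left by everything.\<close>

lemma center_subset:
  assumes u: "u \<in> N" and c: "\<And>i. i \<in> {2..n} \<Longrightarrow> br (e i) u = 0"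
  shows "u \<in> V (n - 1)"
proof -
  obtain \<alpha> v where v: "v \<in> V 2" "u = \<alpha> *s e 1 + v"
    using u N_split by blast
  have "br (e 2) v \<in> V n" using v(1) n_gt by (intro br_V_V) auto
  moreover have "\<alpha> *s br (e 2) (e 1) + br (e 2) v = 0"
    using c[of 2] v(2) n_gt by (simp add: br_linear)
  moreover have "br (e 2) (e 1) = - e 3" using br_e_e1[of 2] n_gt by simp
  ultimately have "\<alpha> *s e 3 \<in> V n" by simp
  then have "\<alpha> = 0" using V_coeff_zero[of \<alpha> 3] V_mono[of "Suc 3" n] n_gt by simp
  then have "u \<in> V 2" using v by simp
  have up: "u \<in> V (Suc m)" if m: "2 \<le> m" "m \<le> n - 2" and um: "u \<in> V m" for m
  proof -
    have "m \<le> n" using m by simp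
    then obtain \<beta> w where w: "w \<in> V (Suc m)" "u = \<beta> *s e m + w"
      using V_split um by blast
    have "br (e (n - m)) w = 0"
      using w(1) m by (intro br_V_V_zero[of _ "n - m" _ "Suc m"]) auto
    then have "\<beta> *s br (e (n - m)) (e m) = 0"
      using c[of "n - m"] w(2) m by (simp add: br_linear)
    then have "\<beta> = 0"
      using m e_nonzero[of n] n_gt by (simp add: br_e_e)
    then show ?thesis using w by simp
  qed
  have "u \<in> V m" if "2 \<le> m" "m \<le> n - 1" for m
    using that
  proof (induction m rule: dec_induct)
    case base
    then show ?case using \<open>u \<in> V 2\<close> by simp
  next
    case (step k)
    then show ?case by (intro up) auto
  qed
  then show ?thesis using n_gt by auto
qed

end

section \<open>The action on the nilradical\<close>

locale g1_ideal = g1_frame scale br n e N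
  for scale :: "complex \<Rightarrow> 'a::ab_group_add \<Rightarrow> 'a" (infixr "*s" 75)
    and br :: "'a \<Rightarrow> 'a \<Rightarrow> 'a" and n e N +
  assumes ideal_left: "u \<in> N \<Longrightarrow> br u y \<in> N" and ideal_right: "u \<in> N \<Longrightarrow> br y u \<in> N"
begin

text \<open>The first two diagonal entries of right multiplication by \<open>x\<close>; as
  \<open>e 1\<close> and \<open>e 2\<close> generate \<open>N\<close>, they determine the others.
  The second condition also says that \<open>[e 2, x]\<close> has no component along
  \<open>e 1\<close>.\<close>

definition has_weights :: "'a \<Rightarrow> complex \<Rightarrow> complex \<Rightarrow> bool" where
  "has_weights x \<alpha> \<beta> \<longleftrightarrow>
     br (e 1) x - \<alpha> *s e 1 \<in> V 2 \<and> br (e 2) x - \<beta> *s e 2 \<in> V 3"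

lemma subspace_N [simp]: "subspace N"
  using V_one subspace_V[of 1] by simp

lemma e_in_N [simp]: "1 \<le> i \<Longrightarrow> i \<le> n \<Longrightarrow> e i \<in> N"
  using V_one e_in_V[of 1] by blast

lemma V2_in_N: "u \<in> V 2 \<Longrightarrow> u \<in> N"
  using V_in_N[of 2] by simp

lemma br_V_N:
  assumes "v \<in> V i" "2 \<le> i" "u \<in> N"
  shows "br v u \<in> V (Suc i)"
proof -
  obtain c w where w: "w \<in> V 2" "u = c *s e 1 + w"
    using assms(3) N_split by blast
  have "br v w \<in> V (Suc i)"
    using assms w(1) by (intro br_V_V_in[of v i w 2]) auto
  moreover have "br v (e 1) = - br (e 1) v"
    using assms n_gt by (intro br_skew V_in_N[of i v]) auto
  then have "c *s br v (e 1) \<in> V (Suc i)"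
    using br_e1_V[OF assms(1,2)] V_closed by simp
  ultimately show ?thesis
    by (simp add: w br_linear V_closed)
qed

lemma br_e1_N:
  assumes "u \<in> N"
  shows "br (e 1) u \<in> V 3"
proof -
  obtain c w where w: "w \<in> V 2" "u = c *s e 1 + w"
    using assms N_split by blast
  then show ?thesis using br_e1_V[of w 2] by (simp add: br_linear)
qed

text \<open>The only obstruction is the component \<open>\<gamma>\<close> of \<open>[e 2, x]\<close>
  along \<open>e 1\<close>. Since \<open>n \<ge> 7\<close>, the product \<open>[e 2, e 3]\<close>
  vanishes; differentiating this relation leaves \<open>\<gamma>\<close> times \<open>e 4\<close>
  plus multiples of \<open>e n\<close>, hence \<open>\<gamma> = 0\<close>.\<close>

lemma has_weights_exist:
  obtains \<alpha> \<beta> where "has_weights x \<alpha> \<beta>"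
proof -
  have "br (e 1) x \<in> N" "br (e 2) x \<in> N"
    using n_gt by (auto intro!: ideal_left)
  then obtain \<alpha> v \<gamma> w where v: "v \<in> V 2" "br (e 1) x = \<alpha> *s e 1 + v"
    and w: "w \<in> V 2" "br (e 2) x = \<gamma> *s e 1 + w"
    using N_split by metis
  have "2 \<le> n" using n_gt by simp
  with w(1) obtain \<beta> w' where w': "w' \<in> V (Suc 2)" "w = \<beta> *s e 2 + w'"
    by (rule V_split)
  have e3: "e 3 = br (e 1) (e 2)" and e4: "e 4 = br (e 1) (e 3)"
    using br_e1_e[of 2] br_e1_e[of 3] n_ge by auto
  have "br (e 3) x = br (e 1) (br (e 2) x) + br (br (e 1) x) (e 2)"
    unfolding e3 by (rule right_mult_derivation)
  also have "\<dots> = br (e 1) w + \<alpha> *s e 3 + br v (e 2)"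
    by (simp add: v w br_linear e3)
  finally have De3: "br (e 3) x = br (e 1) w + \<alpha> *s e 3 + br v (e 2)" .
  have "br (e 1) w \<in> V 3" using br_e1_V[OF w(1)] by simp
  moreover have "br v (e 2) \<in> V 3" using br_V_N[OF v(1)] n_gt by simp
  ultimately have "br (e 3) x \<in> V 2"
    using n_gt by (intro V_mono[of 2 3]) (simp_all add: De3 V_closed)
  then have "br (e 2) (br (e 3) x) \<in> V n"
    using n_gt by (intro br_V_V) auto
  moreover have "br w (e 3) \<in> V n"
    using n_gt w(1) by (intro br_V_V) auto
  moreover have "br (e 2) (e 3) = 0"
    using n_ge by (simp add: br_e_e)
  then have "br (e 2) (br (e 3) x) + (\<gamma> *s e 4 + br w (e 3)) = 0"
    using right_mult_derivation[of "e 2" "e 3" x] w(2) by (simp add: br_linear e4)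
  ultimately have "\<gamma> *s e 4 \<in> V n"
    using V_closed(2)[of "- br (e 2) (br (e 3) x)" n "br w (e 3)"] V_closed(4)
    by (smt (verit) add.commute add_diff_cancel_left' add_eq_0_iff minus_diff_eq diff_minus_eq_add)
  then have "\<gamma> *s e 4 \<in> V (Suc 4)"
    using n_ge by (intro V_mono[of "Suc 4" n]) auto
  then have "\<gamma> = 0" using n_ge by (intro V_coeff_zero[of \<gamma> 4]) auto
  then show ?thesis
    using v w w' by (intro that[of \<alpha> \<beta>]) (simp add: has_weights_def)
qed

text \<open>Elements of \<open>N\<close> act strictly triangularly, so the weights depend only on
  the class of \<open>x\<close> modulo \<open>N\<close>. This permits all later normalisations of
  \<open>x\<close>.\<close>

lemma has_weights_scale_add:
  assumes "has_weights x \<alpha> \<beta>" "u \<in> N"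
  shows "has_weights (c *s x + u) (c * \<alpha>) (c * \<beta>)"
proof -
  have "c *s (br (e 1) x - \<alpha> *s e 1) + br (e 1) u \<in> V 2"
    using assms br_e1_N[of u] V_mono[of 2 3] by (simp add: has_weights_def V_closed)
  moreover have "br (e 2) u \<in> V 3"
    using br_V_N[of "e 2" 2 u] assms n_gt by simp
  then have "c *s (br (e 2) x - \<beta> *s e 2) + br (e 2) u \<in> V 3"
    using assms by (simp add: has_weights_def V_closed)
  ultimately show ?thesis
    by (simp add: has_weights_def br_linear scale_right_diff_distrib algebra_simps)
qed

section \<open>Weights of the whole frame and the symmetrised product\<close>

context
  fixes x \<alpha> \<beta>
  assumes w: "has_weights x \<alpha> \<beta>"
begin

text \<open>Since \<open>e (Suc i) = [e 1, e i]\<close>, the derivation rule adds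
  \<open>\<alpha>\<close> to the weight at each step, and both error terms move one index down the
  flag.\<close>

lemma br_e_x:
  assumes "2 \<le> i" "i \<le> n - 1"
  shows "br (e i) x - ((of_nat i - 2) * \<alpha> + \<beta>) *s e i \<in> V (Suc i)"
  using assms
proof (induction i rule: dec_induct)
  case base
  then show ?case using w by (simp add: has_weights_def numeral_eq_Suc)
next
  case (step i)
  define \<mu> where "\<mu> = (of_nat i - 2) * \<alpha> + \<beta>"
  define v where "v = br (e i) x - \<mu> *s e i"
  define v1 where "v1 = br (e 1) x - \<alpha> *s e 1"
  have v: "v \<in> V (Suc i)" "br (e i) x = \<mu> *s e i + v"
    using step by (auto simp: v_def \<mu>_def)
  have v1: "v1 \<in> V 2" "br (e 1) x = \<alpha> *s e 1 + v1"
    using w by (auto simp: v1_def has_weights_def)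
  have ei: "e (Suc i) = br (e 1) (e i)"
    using br_e1_e[of i] step by simp
  have "br (e (Suc i)) x = br (e 1) (br (e i) x) + br (br (e 1) x) (e i)"
    unfolding ei by (rule right_mult_derivation)
  also have "\<dots> = (\<mu> + \<alpha>) *s e (Suc i) + br (e 1) v + br v1 (e i)"
    by (simp add: v v1 br_linear ei scale_left_distrib)
  finally have "br (e (Suc i)) x - ((of_nat (Suc i) - 2) * \<alpha> + \<beta>) *s e (Suc i) = br (e 1) v + br v1 (e i)"
    by (simp add: \<mu>_def algebra_simps)
  moreover have "br (e 1) v \<in> V (Suc (Suc i))"
    using br_e1_V[OF v(1)] step by simp
  moreover have "br v1 (e i) \<in> V (Suc (Suc i))"
    using v1(1) step by (intro br_V_V_in[of v1 2 "e i" i]) auto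
  ultimately show ?case by (simp add: V_closed)
qed

text \<open>\<open>e n\<close> is the product of \<open>e 2\<close> and \<open>e (n - 2)\<close>, so
  their weights add. The equation is exact because the error terms have index sums above
  \<open>n\<close>.\<close>

lemma br_e_n_x: "br (e n) x = ((of_nat n - 4) * \<alpha> + 2 * \<beta>) *s e n"
proof -
  define \<mu> where "\<mu> = (of_nat (n - 2) - 2) * \<alpha> + \<beta>"
  define v where "v = br (e (n - 2)) x - \<mu> *s e (n - 2)"
  define v2 where "v2 = br (e 2) x - \<beta> *s e 2"
  have "Suc (n - 2) = n - 1" using n_gt by simp
  then have v: "v \<in> V (n - 1)" "br (e (n - 2)) x = \<mu> *s e (n - 2) + v"
    using br_e_x[of "n - 2"] n_gt by (auto simp: v_def \<mu>_def)
  have v2: "v2 \<in> V 3" "br (e 2) x = \<beta> *s e 2 + v2"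
    using w by (auto simp: v2_def has_weights_def)
  have "2 + (n - 2) = n" using n_gt by simp
  then have en: "e n = br (e 2) (e (n - 2))" using n_gt by (simp add: br_e_e del: add_2_eq_Suc)
  have "br (e 2) v = 0" using v(1) n_gt by (intro center_left) auto
  moreover have "br v2 (e (n - 2)) = 0"
    using v2(1) n_gt by (intro br_V_V_zero[of v2 3 _ "n - 2"]) auto
  moreover have "br (e n) x = br (e 2) (br (e (n - 2)) x) + br (br (e 2) x) (e (n - 2))"
    unfolding en by (rule right_mult_derivation)
  ultimately have "br (e n) x = (\<mu> + \<beta>) *s e n"
    by (simp add: v(2) v2(2) br_linear en scale_left_distrib)
  moreover have "\<mu> + \<beta> = (of_nat n - 4) * \<alpha> + 2 * \<beta>"
    using n_gt by (simp add: \<mu>_def of_nat_diff algebra_simps)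
  ultimately show ?thesis by simp
qed

lemma br_V_x:
  assumes "u \<in> V m" "1 \<le> m"
  shows "br u x \<in> V m"
proof (rule br_left_in_subspace[of u "e ` {m..n}"])
  fix s assume "s \<in> e ` {m..n}"
  then obtain i where i: "s = e i" "m \<le> i" "i \<le> n" by auto
  consider "i = 1" | "2 \<le> i" "i \<le> n - 1" | "i = n"
    using i assms by linarith
  then show "br s x \<in> V m"
  proof cases
    case 1
    then have "m = 1" using i assms by simp
    then show ?thesis using i V_one ideal_left by simp
  next
    case 2
    then have "br (e i) x - ((of_nat i - 2) * \<alpha> + \<beta>) *s e i \<in> V m"
      using V_mono[OF _ br_e_x[of i], of m] i by simp
    then show ?thesis
      using i V_closed(1)[OF _ V_closed(3)[OF e_in_V[of m i]], of _ "(of_nat i - 2) * \<alpha> + \<beta>"] by fastforce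
  qed (use i in \<open>auto simp: br_e_n_x V_closed\<close>)
qed (use assms in \<open>auto simp: V_def\<close>)

lemma br_V_x_nil:
  assumes "\<alpha> = 0" "\<beta> = 0" "u \<in> V m" "1 \<le> m"
  shows "br u x \<in> V (Suc m)"
proof (rule br_left_in_subspace[of u "e ` {m..n}"])
  fix s assume "s \<in> e ` {m..n}"
  then obtain i where i: "s = e i" "m \<le> i" "i \<le> n" by auto
  consider "i = 1" | "2 \<le> i" "i \<le> n - 1" | "i = n"
    using i assms by linarith
  then show "br s x \<in> V (Suc m)"
  proof cases
    case 1
    then have "m = 1" using i assms by simp
    then show ?thesis using 1 i w assms(1) by (simp add: has_weights_def Suc_1)
  next
    case 2
    then show ?thesis
      using V_mono[OF _ br_e_x[of i], of "Suc m"] i assms by simp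
  qed (use i assms in \<open>auto simp: br_e_n_x V_closed\<close>)
qed (use assms in \<open>auto simp: V_def\<close>)

text \<open>On the span of \<open>e (n - 1)\<close> and \<open>e n\<close> the map
  \<open>[_, x]\<close> is triangular, and the two numbers assumed nonzero are its diagonal entries,
  so it is injective there.\<close>

lemma center_kernel_zero:
  assumes "u \<in> V (n - 1)" "br u x = 0"
    and "(of_nat n - 3) * \<alpha> + \<beta> \<noteq> 0" "(of_nat n - 4) * \<alpha> + 2 * \<beta> \<noteq> 0"
  shows "u = 0"
proof -
  have n1: "Suc (n - 1) = n" "n - 1 \<le> n" using n_gt by auto
  obtain \<delta> t where t: "t \<in> V (Suc (n - 1))" "u = \<delta> *s e (n - 1) + t"
    using assms(1) n1(2) by (rule V_split)
  then obtain \<epsilon> where \<epsilon>: "t = \<epsilon> *s e n" using V_top n1 by auto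
  define \<mu> where "\<mu> = (of_nat n - 3) * \<alpha> + \<beta>"
  have n3: "of_nat (n - 1) - 2 = (of_nat n - 3 :: complex)"
    using n_gt by (simp add: of_nat_diff)
  have "br (e (n - 1)) x - \<mu> *s e (n - 1) \<in> V n"
    using br_e_x[of "n - 1"] n_gt n1 by (simp add: n3 \<mu>_def)
  then have "\<delta> *s (br (e (n - 1)) x - \<mu> *s e (n - 1)) + \<epsilon> *s br (e n) x \<in> V n"
    using br_V_x[of "e n" n] n_gt by (simp add: V_closed)
  then have "- (\<delta> * \<mu>) *s e (n - 1) \<in> V n"
    using assms(2) by (simp add: t(2) \<epsilon> br_linear algebra_simps)
  then have "\<delta> * \<mu> = 0"
    using V_coeff_zero[of "- (\<delta> * \<mu>)" "n - 1"] n1 n_gt by simp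
  then have "\<delta> = 0" using assms(3) by (simp add: \<mu>_def)
  then have "\<epsilon> = 0"
    using assms(2,4) e_nonzero[of n] n_gt by (simp add: t(2) \<epsilon> br_linear br_e_n_x)
  then show ?thesis using \<open>\<delta> = 0\<close> by (simp add: t(2) \<epsilon>)
qed

text \<open>The symmetrised product \<open>z v = [v, x] + [x, v]\<close> is central, vanishes on \<open>[N, N]\<close> and is
  annihilated by \<open>[\<cdot>, x]\<close> on either side, which leaves no room for it when \<open>x\<close> does not
  act nilpotently.\<close>

lemma left_mult_eq_neg_right_mult:
  assumes xx: "br x x \<in> N" and nz: "\<alpha> \<noteq> 0 \<or> \<beta> \<noteq> 0" and "v \<in> N"
  shows "br x v = - br v x"
proof -
  define z where "z v = br v x + br x v" for v
  have z_lin: "z (u + v) = z u + z v" "z (c *s u) = c *s z u" for u v c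
    by (simp_all add: z_def br_linear scale_right_distrib algebra_simps)
  have xx_center: "br x x \<in> V (n - 1)"
    using xx by (intro center_subset) auto
  have z_center: "z v \<in> V (n - 1)" if "v \<in> N" for v
    using that ideal_left ideal_right
    by (intro center_subset) (auto simp: z_def subspace_add)
  \<comment> \<open>As \<open>z u\<close> and \<open>z v\<close> are central in \<open>N\<close>,
    \<open>[x, u]\<close> and \<open>[x, v]\<close> may be replaced by \<open>- [u, x]\<close> and
    \<open>- [v, x]\<close> inside products; the derivation rule then cancels everything.\<close>
  have z_br: "z (br u v) = 0" if "u \<in> N" "v \<in> N" for u v
  proof -
    have c: "br (z u) v = 0" "br (z v) u = 0"
      using that z_center center_right by auto
    have "br x (br u v) = br (br x u) v - br (br x v) u"
      by (rule leibniz)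
    also have "\<dots> = br (z u - br u x) v - br (z v - br v x) u"
      by (simp add: z_def)
    also have "\<dots> = - br (br u x) v + br (br v x) u"
      using c by (simp add: br_linear)
    also have "br (br v x) u = - br u (br v x)"
      using that ideal_left by (intro br_skew) auto
    finally show ?thesis
      using right_mult_derivation[of u v x] by (simp add: z_def)
  qed
  have z_e: "z (e i) = 0" if "3 \<le> i" "i \<le> n" for i
  proof (cases "i = n")
    case True
    have "2 + (n - 2) = n" using n_gt by simp
    then have "e n = br (e 2) (e (n - 2))" using n_gt by (simp add: br_e_e del: add_2_eq_Suc)
    then show ?thesis using z_br[of "e 2" "e (n - 2)"] True n_gt by simp
  next
    case False
    have "e i = br (e 1) (e (i - 1))" using br_e1_e[of "i - 1"] that False by simp
    then show ?thesis using z_br[of "e 1" "e (i - 1)"] that by simp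
  qed
  have z_V3: "z u = 0" if "u \<in> V 3" for u
    using that unfolding V_def
  proof (induction rule: span_induct_alt)
    case base
    then show ?case by (simp add: z_def)
  qed (auto simp: z_lin z_e)
  have zz: "z (z v) = 0" if "v \<in> N" for v
    using z_center[OF that] V_mono[of 3 "n - 1"] z_V3 n_gt by simp
  \<comment> \<open>\<open>[x, z v]\<close> vanishes because \<open>z v\<close> is a symmetrised
    product, so \<open>z (z v) = 0\<close> reduces to this.\<close>
  have D_z: "br (z v) x = 0" if "v \<in> N" for v
    using zz[OF that] by (simp add: z_def[of "z v"]) (simp add: z_def)
  have z_D: "z (br v x) = 0" if "v \<in> N" for v
  proof -
    have "br x (br v x) = br (br x v) x - br (br x x) v" by (rule leibniz)
    also have "br (br x x) v = 0" using xx_center that by (rule center_right)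
    finally have "z (br v x) = br (z v) x" by (simp add: z_def br_linear)
    then show ?thesis using D_z that by simp
  qed
  define v1 where "v1 = br (e 1) x - \<alpha> *s e 1"
  define v2 where "v2 = br (e 2) x - \<beta> *s e 2"
  have v1: "v1 \<in> V 2" "br (e 1) x = \<alpha> *s e 1 + v1"
    and v2: "v2 \<in> V 3" "br (e 2) x = \<beta> *s e 2 + v2"
    using w by (auto simp: v1_def v2_def has_weights_def)
  have z2: "\<beta> *s z (e 2) = 0"
    using z_D[of "e 2"] z_V3 v2 n_gt by (simp add: z_lin)
  have "2 \<le> n" using n_gt by simp
  with v1(1) obtain c v3 where v3: "v3 \<in> V (Suc 2)" "v1 = c *s e 2 + v3"
    by (rule V_split)
  have z1: "\<alpha> *s z (e 1) + c *s z (e 2) = 0"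
    using z_D[of "e 1"] z_V3[of v3] v1(2) v3 n_gt by (simp add: z_lin)
  have n34: "(of_nat n - 3 :: complex) \<noteq> 0" "(of_nat n - 4 :: complex) \<noteq> 0"
    using n_gt of_nat_eq_iff[where 'a = complex, of n 3] of_nat_eq_iff[where 'a = complex, of n 4] by auto
  \<comment> \<open>If exactly one of the two weights vanishes, both diagonal entries on the last
    two basis vectors are nonzero, so \<open>[z u, x] = 0\<close> already forces
    \<open>z u = 0\<close>.\<close>
  have kernel: "z u = 0" if "u \<in> N" "\<alpha> = 0 \<or> \<beta> = 0" for u
    by (rule center_kernel_zero[OF z_center[OF that(1)] D_z[OF that(1)]]) (use that(2) nz n34 in auto)
  have "z (e 1) = 0 \<and> z (e 2) = 0"
  proof (cases "\<alpha> = 0 \<or> \<beta> = 0")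
    case True
    then show ?thesis using kernel n_gt by simp
  next
    case False
    then show ?thesis using z1 z2 by simp
  qed
  then have z_all: "z (e i) = 0" if "1 \<le> i" "i \<le> n" for i
    using z_e[of i] that by (cases "i = 1"; cases "i = 2") auto
  have "v \<in> span (e ` {1..n})" using \<open>v \<in> N\<close> V_one by (simp add: V_def)
  then have "z v = 0"
  proof (induction rule: span_induct_alt)
    case base
    then show ?case by (simp add: z_def)
  qed (auto simp: z_lin z_all)
  then show ?thesis by (simp add: z_def add_eq_0_iff)
qed

end

section \<open>Frames of eigenvectors\<close>

text \<open>A unitriangular change of frame preserves every \<open>V m\<close>; downward induction
  from \<open>V (Suc n) = {0}\<close> adds one vector at a time.\<close>

lemma triangular_frame:
  assumes tri: "\<And>i. 1 \<le> i \<Longrightarrow> i \<le> n \<Longrightarrow> f i - e i \<in> V (Suc i)"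
  shows "inj_on f {1..n}" "independent (f ` {1..n})" "span (f ` {1..n}) = N"
proof -
  have "inj_on f {m..n} \<and> independent (f ` {m..n}) \<and> span (f ` {m..n}) = V m"
    if "m \<le> Suc n" "1 \<le> m" for m
    using that
  proof (induction m rule: inc_induct)
    case base
    then show ?case by (simp add: V_empty independent_empty)
  next
    case (step m)
    then have IH: "inj_on f {Suc m..n}" "independent (f ` {Suc m..n})"
        "span (f ` {Suc m..n}) = V (Suc m)" and m: "1 \<le> m" "m \<le> n"
      by auto
    have split: "{m..n} = insert m {Suc m..n}" using m by auto
    have f_notin: "f m \<notin> V (Suc m)"
    proof
      assume "f m \<in> V (Suc m)"
      then have "1 *s e m \<in> V (Suc m)"
        using V_closed(2)[OF _ tri[OF m], of "f m"] by simp
      then show False using V_coeff_zero[of 1 m] m by simp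
    qed
    have "f m \<notin> f ` {Suc m..n}"
      using f_notin IH(3) span_base by blast
    then have "inj_on f {m..n}" using IH(1) by (simp add: split)
    moreover have "independent (f ` {m..n})"
      using f_notin IH by (simp add: split independent_insertI)
    moreover have "span (f ` {m..n}) = V m"
    proof
      have "f m \<in> V m"
        using V_closed(1)[OF V_mono[OF _ tri[OF m], of m] e_in_V[of m m]] m by simp
      moreover have "f ` {Suc m..n} \<subseteq> V m"
        using span_superset[of "f ` {Suc m..n}"] V_mono[of m "Suc m"] unfolding IH(3) by auto
      ultimately show "span (f ` {m..n}) \<subseteq> V m"
        by (intro span_minimal) (auto simp: split)
      have sub: "V (Suc m) \<subseteq> span (f ` {m..n})"
        using IH(3) span_mono[of "f ` {Suc m..n}" "f ` {m..n}"] by (auto simp: split)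
      have "f m - (f m - e m) \<in> span (f ` {m..n})"
        by (rule span_diff) (use sub tri[OF m] m in \<open>auto intro: span_base\<close>)
      then have "e ` {m..n} \<subseteq> span (f ` {m..n})"
        using sub by (auto simp: split)
      then show "V m \<subseteq> span (f ` {m..n})"
        unfolding V_def by (intro span_minimal) auto
    qed
    ultimately show ?case by blast
  qed
  from this[of 1] show "inj_on f {1..n}" "independent (f ` {1..n})" "span (f ` {1..n}) = N"
    using V_one n_gt by auto
qed

text \<open>The frame is generated by \<open>f 1\<close> and \<open>f 2\<close>, eigenvectors of
  \<open>[_, x]\<close> up to resonance terms with coefficients \<open>a\<close>, \<open>s\<close>
  and \<open>r\<close>; the first weight is normalised to \<open>1\<close>. The vector
  \<open>e n\<close> is kept as \<open>f n\<close>.\<close>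

context
  fixes f x a \<beta> s r
  assumes f1: "f 1 - e 1 \<in> V 2" and f2: "f 2 - e 2 \<in> V 3" and fn: "f n = e n"
    and rec: "\<And>i. 2 \<le> i \<Longrightarrow> i \<le> n - 2 \<Longrightarrow> f (Suc i) = br (f 1) (f i)"
    and f1x: "br (f 1) x = f 1 + a *s f 2 + s *s e n"
    and f2x: "br (f 2) x = \<beta> *s f 2 + r *s e n"
    and enx: "br (e n) x = (of_nat n - 4 + 2 * \<beta>) *s e n"
begin

lemma eigen_triangular:
  assumes "1 \<le> i" "i \<le> n"
  shows "f i - e i \<in> V (Suc i)"
proof -
  have tri: "f i - e i \<in> V (Suc i)" if "2 \<le> i" "i \<le> n - 1" for i
    using that
  proof (induction i rule: dec_induct)
    case base
    then show ?case using f2 by (simp add: numeral_eq_Suc)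
  next
    case (step i)
    define v w where "v = f i - e i" and "w = f 1 - e 1"
    have v: "v \<in> V (Suc i)" "f i = e i + v" and w: "w \<in> V 2" "f 1 = e 1 + w"
      using step f1 by (auto simp: v_def w_def)
    have "f i \<in> V i"
      using v V_mono[of i "Suc i"] step by (simp add: V_closed)
    then have "br w (f i) \<in> V (Suc (Suc i))"
      using w(1) step by (intro br_V_V_in[of w 2 "f i" i]) auto
    moreover have "br (e 1) v \<in> V (Suc (Suc i))"
      using br_e1_V[OF v(1)] step by simp
    moreover have "f (Suc i) = e (Suc i) + br (e 1) v + br w (f i)"
      using rec[of i] br_e1_e[of i] step by (simp add: w(2) br_add_left) (simp add: v(2) br_add_right)
    ultimately show ?case by (simp add: V_closed)
  qed
  have "i = 1 \<or> 2 \<le> i \<and> i \<le> n - 1 \<or> i = n" using assms by linarith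
  then show ?thesis
    using tri f1 fn V_closed(5) by (auto simp: Suc_1)
qed

lemma eigen_in_V:
  assumes "1 \<le> i" "i \<le> n"
  shows "f i \<in> V i"
  using V_closed(1)[OF V_mono[OF _ eigen_triangular[OF assms], of i] e_in_V[of i i]] assms by simp

text \<open>Passing from \<open>e\<close> to \<open>f\<close> only adds products whose indices sum
  to more than \<open>n\<close>, and these vanish.\<close>

lemma eigen_br_dual:
  assumes "2 \<le> i" "2 \<le> j" "i + j = n"
  shows "br (f i) (f j) = (- 1) ^ i *s e n"
proof -
  define v w where "v = f i - e i" and "w = f j - e j"
  have v: "v \<in> V (Suc i)" "f i = e i + v" and w: "w \<in> V (Suc j)" "f j = e j + w"
    using assms eigen_triangular by (auto simp: v_def w_def)
  have "br v (f j) = 0"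
    using assms v(1) eigen_in_V[of j] by (intro br_V_V_zero[of v "Suc i" _ j]) auto
  moreover have "br (e i) w = 0"
    using assms w(1) by (intro br_V_V_zero[of _ i w "Suc j"]) auto
  moreover have "br (f i) (f j) = br (e i) (e j) + br (e i) w + br v (f j)"
    by (simp add: v(2) br_add_left) (simp add: w(2) br_add_right)
  ultimately show ?thesis using assms by (simp add: br_e_e)
qed

text \<open>The product is a multiple of \<open>e n\<close>, of weight
  \<open>n - 4 + 2 * \<beta>\<close>, while the derivation rule gives it weight
  \<open>i + j - 4 + 2 * \<beta>\<close>; these differ whatever \<open>\<beta>\<close> is.
  Eigenvectors modulo \<open>V n\<close> suffice because \<open>e n\<close> is central in
  \<open>N\<close>.\<close>

lemma eigen_weight_zero:
  assumes "br (f i) x - (of_nat i - 2 + \<beta>) *s f i \<in> V n"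
    and "br (f j) x - (of_nat j - 2 + \<beta>) *s f j \<in> V n"
    and "2 \<le> i" "i \<le> n" "2 \<le> j" "j \<le> n" "i + j \<noteq> n"
  shows "br (f i) (f j) = 0"
proof -
  obtain c where c: "br (f i) x = (of_nat i - 2 + \<beta>) *s f i + c *s e n"
    using assms(1) by (metis V_top diff_add_cancel add.commute)
  obtain d where d: "br (f j) x = (of_nat j - 2 + \<beta>) *s f j + d *s e n"
    using assms(2) by (metis V_top diff_add_cancel add.commute)
  have V2: "f i \<in> V 2" "f j \<in> V 2"
    using assms eigen_in_V V_mono by auto
  then obtain t where t: "br (f i) (f j) = t *s e n"
    using br_V_V V_top by metis
  have "br (e n) (f j) = 0" "br (f i) (e n) = 0"
    using center_right[of "e n" "f j"] center_left[of "e n" "f i"] V2_in_N[OF V2(1)] V2_in_N[OF V2(2)]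
    by auto
  then have "br (br (f i) (f j)) x = (of_nat (i + j) - 4 + 2 * \<beta>) *s br (f i) (f j)"
    using right_mult_derivation[of "f i" "f j" x] c d
    by (simp add: br_linear algebra_simps flip: scale_left_distrib scale_left_diff_distrib)
  then have "t * (of_nat n - 4 + 2 * \<beta>) = t * (of_nat (i + j) - 4 + 2 * \<beta>)"
    using e_nonzero[of n] n_gt enx by (simp add: t br_linear mult.commute)
  then have "t * of_nat n = t * of_nat (i + j)"
    by (simp add: algebra_simps)
  then have "t = 0"
    using assms(7) of_nat_eq_iff[of n "i + j", where 'a = complex] by auto
  then show ?thesis by (simp add: t)
qed

text \<open>Bracketing with \<open>f 1\<close> kills the multiple of \<open>e n\<close> in
  \<open>[f i, x]\<close>, and the \<open>s\<close>-term of \<open>[f 1, x]\<close> dies against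
  \<open>f i\<close>. Of the resonances only the one with coefficient \<open>a\<close> can
  survive.\<close>

lemma eigen_step:
  assumes "2 \<le> i" "i \<le> n - 2" "br (f i) x - (of_nat i - 2 + \<beta>) *s f i \<in> V n"
  shows "br (f (Suc i)) x = (of_nat (Suc i) - 2 + \<beta>) *s f (Suc i) + a *s br (f 2) (f i)"
proof -
  define \<mu> where "\<mu> = of_nat i - 2 + \<beta>"
  obtain c where c: "br (f i) x = \<mu> *s f i + c *s e n"
    using assms(3) by (metis V_top diff_add_cancel add.commute \<mu>_def)
  have "f 1 \<in> N" "f i \<in> N"
    using V_in_N[of 1 "f 1"] V_in_N[of i "f i"] eigen_in_V[of 1] eigen_in_V[of i] assms n_gt by auto
  then have "br (f 1) (e n) = 0" "br (e n) (f i) = 0"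
    using center_right[of "e n" "f i"] center_left[of "e n" "f 1"] by auto
  moreover have "br (f (Suc i)) x = br (f 1) (br (f i) x) + br (br (f 1) x) (f i)"
    unfolding rec[OF assms(1,2)] by (rule right_mult_derivation)
  ultimately have "br (f (Suc i)) x = (\<mu> + 1) *s f (Suc i) + a *s br (f 2) (f i)"
    by (simp add: c f1x br_linear rec[OF assms(1,2)] scale_left_distrib)
  then show ?thesis by (simp add: \<mu>_def algebra_simps)
qed

text \<open>In each induction step \<open>i < n - 2\<close>, so \<open>[f 2, f i]\<close> vanishes
  by comparison of weights and the resonance \<open>a\<close> is not passed on.\<close>

lemma eigen_weight_mod:
  assumes "2 \<le> i" "i \<le> n - 2"
  shows "br (f i) x - (of_nat i - 2 + \<beta>) *s f i \<in> V n"
  using assms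
proof (induction i rule: dec_induct)
  case base
  then show ?case by (simp add: f2x V_closed)
next
  case (step i)
  then have IH: "br (f i) x - (of_nat i - 2 + \<beta>) *s f i \<in> V n" by simp
  have "br (f 2) x - (of_nat 2 - 2 + \<beta>) *s f 2 \<in> V n"
    by (simp add: f2x V_closed)
  then have "br (f 2) (f i) = 0"
    using IH step by (intro eigen_weight_zero) auto
  then show ?case
    using eigen_step[OF _ _ IH] step V_closed(5) by simp
qed

text \<open>Weights modulo \<open>V n\<close> are known up to index \<open>n - 2\<close>; a factor
  of larger index is central in \<open>N\<close>.\<close>

lemma eigen_br:
  assumes "2 \<le> i" "i \<le> n" "2 \<le> j" "j \<le> n"
  shows "br (f i) (f j) = (if i + j = n then (- 1) ^ i *s f n else 0)"
proof (cases "i + j = n")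
  case True
  then show ?thesis using assms eigen_br_dual fn by simp
next
  case False
  have N: "f i \<in> N" "f j \<in> N"
    using assms eigen_in_V V_in_N by (meson le_trans one_le_numeral)+
  consider "n - 1 \<le> i" | "n - 1 \<le> j" | "i \<le> n - 2" "j \<le> n - 2" by linarith
  then show ?thesis
  proof cases
    case 1
    then have "f i \<in> V (n - 1)" using V_mono eigen_in_V assms by simp
    then show ?thesis using center_right N False by simp
  next
    case 2
    then have "f j \<in> V (n - 1)" using V_mono eigen_in_V assms by simp
    then show ?thesis using center_left N False by simp
  next
    case 3
    then show ?thesis
      using False assms eigen_weight_mod eigen_weight_zero by simp
  qed
qed

text \<open>From index \<open>3\<close> on the equation is exact: one bracket with
  \<open>f 1\<close> has removed the term \<open>r\<close> present at \<open>f 2\<close>.\<close>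

lemma eigen_weight:
  assumes "3 \<le> i" "i \<le> n - 2"
  shows "br (f i) x = (of_nat i - 2 + \<beta>) *s f i"
proof -
  define k where "k = i - 1"
  have k: "i = Suc k" "2 \<le> k" "k \<le> n - 2" using assms by (auto simp: k_def)
  have "br (f 2) (f k) = 0" using eigen_br[of 2 k] k assms by auto
  then show ?thesis using eigen_step[of k] eigen_weight_mod[of k] k by simp
qed

text \<open>Here the pairing \<open>[f 2, f (n - 2)] = f n\<close> is nonzero, so the resonance of
  \<open>f 1\<close> with \<open>f 2\<close> reappears between \<open>f (n - 1)\<close> and
  \<open>f n\<close>, with the same coefficient.\<close>

lemma eigen_weight_top:
  "br (f (n - 1)) x = (of_nat n - 3 + \<beta>) *s f (n - 1) + a *s f n"
proof -
  have n2: "Suc (n - 2) = n - 1" "2 + (n - 2) = n" using n_gt by auto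
  have "br (f 2) (f (n - 2)) = f n"
    using eigen_br[of 2 "n - 2"] n_gt n2(2) by (simp del: add_2_eq_Suc)
  moreover have "of_nat (n - 1) - 2 = (of_nat n - 3 :: complex)"
    using n_gt by (simp add: of_nat_diff)
  ultimately show ?thesis
    using eigen_step[of "n - 2"] eigen_weight_mod[of "n - 2"] n_gt by (simp add: n2(1))
qed

lemma eigen_g1_basis: "g1_basis scale br n f N"
proof (rule g1_basisI[OF n_odd n_gt triangular_frame[of f, OF eigen_triangular]])
  fix i j assume "i \<in> {1..n}" "j \<in> {1..n}"
  then show "br (f j) (f i) = - br (f i) (f j)"
    using eigen_in_V V_in_N by (intro br_skew) auto
next
  have "f 1 \<in> N" "f (n - 1) \<in> V (n - 1)" "f n \<in> V (n - 1)"
    using eigen_in_V[of 1] eigen_in_V[of "n - 1"] V_mono[OF _ eigen_in_V[of n], of "n - 1"]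
      V_in_N[of 1 "f 1"] n_gt by auto
  then show "br (f 1) (f (n - 1)) = 0" "br (f 1) (f n) = 0"
    using center_left by auto
next
  fix i j assume "i \<in> {2..n}" "j \<in> {2..n}"
  then show "br (f i) (f j) = (if i + j = n then (- 1) ^ i *s f n else 0)"
    by (intro eigen_br) auto
next
  fix i assume "2 \<le> i" "i \<le> n - 2"
  then show "br (f 1) (f i) = f (i + 1)"
    using rec[of i] by (simp only: Suc_eq_plus1)
qed

end


end

section \<open>Coefficient tables\<close>

context leibniz
begin

lemma lincomb_add: "lincomb scale n e (\<lambda>k. c k + d k) = lincomb scale n e c + lincomb scale n e d"
  by (simp add: lincomb_def scale_left_distrib sum.distrib)

lemma lincomb_delta:
  "j \<in> {1..n} \<Longrightarrow> lincomb scale n e (\<lambda>k. if k = j then c else 0) = c *s e j"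
  by (rule lincomb_single) auto

lemma x_brackets_cong:
  assumes "x_brackets scale br n e x c d"
    and "\<And>i k. i \<in> {1..n} \<Longrightarrow> k \<in> {1..n} \<Longrightarrow> c i k = c' i k" "\<And>k. k \<in> {1..n} \<Longrightarrow> d k = d' k"
  shows "x_brackets scale br n e x c' d'"
proof -
  have "lincomb scale n e (c i) = lincomb scale n e (c' i)" if "i \<in> {1..n}" for i
    using that assms(2) by (simp add: lincomb_def)
  moreover have "lincomb scale n e d = lincomb scale n e d'"
    using assms(3) by (simp add: lincomb_def)
  ultimately show ?thesis
    using assms(1) by (simp add: x_brackets_def)
qed

end

text \<open>The common shape of \<open>R\<^sub>2, \<dots>, R\<^sub>7\<close>: \<open>a\<close>, \<open>t\<close>, \<open>s\<close> are the resonances of \<open>e\<^sub>1\<close> with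
  \<open>e\<^sub>2\<close>, \<open>e\<^bsub>n-1\<^esub>\<close> and \<open>e\<^sub>n\<close>.\<close>

definition diag_table :: "nat \<Rightarrow> complex \<Rightarrow> complex \<Rightarrow> complex \<Rightarrow> complex \<Rightarrow> nat \<Rightarrow> nat \<Rightarrow> complex" where
  "diag_table n \<beta> a t s i k =
     (if k = i then if i = 1 then 1 else if i = n then of_nat n - 4 + 2 * \<beta> else of_nat i - 2 + \<beta> else 0)
     + (if k = 2 then if i = 1 then a else 0 else 0)
     + (if k = n - 1 then if i = 1 then t else 0 else 0)
     + (if k = n then if i = 1 then s else if i = n - 1 then a else 0 else 0)"

text \<open>The special values of \<open>\<beta>\<close> have a meaning in terms of weights. In
  order, they give \<open>e (n - 1)\<close> weight \<open>1\<close>, \<open>e (n - 1)\<close> weight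
  \<open>0\<close>, \<open>e n\<close> weight \<open>0\<close>, \<open>e n\<close> weight
  \<open>1\<close>, and \<open>e 2\<close> weight \<open>1\<close>. Weight \<open>1\<close> is a
  resonance with \<open>e 1\<close>; weight \<open>0\<close> leaves room for a square.\<close>

lemma diag_table_eq:
  assumes "n > 5" "i \<in> {1..n}" "k \<in> {1..n}"
  shows "diag_table n (4 - of_nat n) 0 t 0 i k = R2c n t i k"
    and "diag_table n (3 - of_nat n) 0 0 0 i k = R3c n i k"
    and "diag_table n ((4 - of_nat n) / 2) 0 0 0 i k = R4c n i k"
    and "diag_table n ((5 - of_nat n) / 2) 0 0 t i k = R5c n t i k"
    and "diag_table n 1 t 0 0 i k = R6c n t i k"
    and "diag_table n \<beta> 0 0 0 i k = R7c n \<beta> i k"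
proof -
  obtain p where n: "n = Suc p" "p > 4" using assms(1) by (cases n) auto
  have le: "j \<le> p - 1 \<longleftrightarrow> j < p" for j using n by auto
  note defs = diag_table_def R2c_def R3c_def R4c_def R5c_def R6c_def R7c_def le diff_divide_distrib
  consider "i = 1" | "i = p" "i \<noteq> 1" | "i = Suc p" "i \<noteq> 1" | "2 \<le> i" "i < p" "i \<noteq> p" "i \<noteq> Suc p"
    using assms n by fastforce
  note cases = this
  show "diag_table n (4 - of_nat n) 0 t 0 i k = R2c n t i k"
    using cases by cases (use n in \<open>simp_all add: defs\<close>)
  show "diag_table n (3 - of_nat n) 0 0 0 i k = R3c n i k"
    using cases by cases (use n in \<open>simp_all add: defs\<close>)
  show "diag_table n ((4 - of_nat n) / 2) 0 0 0 i k = R4c n i k"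
    using cases by cases (use n in \<open>simp_all add: defs del: of_nat_Suc\<close>)
  show "diag_table n ((5 - of_nat n) / 2) 0 0 t i k = R5c n t i k"
    using cases by cases (use n in \<open>simp_all add: defs del: of_nat_Suc\<close>)
  show "diag_table n 1 t 0 0 i k = R6c n t i k"
    using cases by cases (use n in \<open>simp_all add: defs\<close>)
  show "diag_table n \<beta> 0 0 0 i k = R7c n \<beta> i k"
    using cases by cases (use n in \<open>simp_all add: defs\<close>)
qed

lemma (in leibniz) lincomb_diag_table:
  assumes "n > 5" "i \<in> {1..n}"
  shows "lincomb scale n f (diag_table n \<beta> a t s i) =
    (if i = 1 then 1 else if i = n then of_nat n - 4 + 2 * \<beta> else of_nat i - 2 + \<beta>) *s f i
    + (if i = 1 then a else 0) *s f 2 + (if i = 1 then t else 0) *s f (n - 1)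
    + (if i = 1 then s else if i = n - 1 then a else 0) *s f n"
  using assms unfolding diag_table_def by (simp add: lincomb_add lincomb_delta)

section \<open>Diagonalisation for nonzero first weight\<close>

context g1_ideal
begin

text \<open>Starting from \<open>e 2\<close>, the error is pushed down the flag one index at a time.
  The weight of \<open>e (Suc m)\<close> exceeds \<open>\<beta>\<close> by \<open>m - 1\<close>,
  which is nonzero, so a multiple of \<open>e (Suc m)\<close> cancels the leading error. The process
  stops at \<open>e n\<close>, whose weight may coincide with \<open>\<beta>\<close>.\<close>

lemma eigenvector_mod_top:
  assumes w: "has_weights x 1 \<beta>"
  obtains g where "g - e 2 \<in> V 3" "br g x - \<beta> *s g \<in> V n"
proof -
  have "\<exists>g. g - e 2 \<in> V 3 \<and> br g x - \<beta> *s g \<in> V (Suc m)" if "2 \<le> m" "m \<le> n - 1" for m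
    using that
  proof (induction m rule: dec_induct)
    case base
    then show ?case
      using w V_closed(5) by (intro exI[of _ "e 2"]) (simp add: has_weights_def numeral_eq_Suc)
  next
    case (step m)
    then obtain g where g: "g - e 2 \<in> V 3" "br g x - \<beta> *s g \<in> V (Suc m)" by auto
    have "Suc m \<le> n" using step by simp
    with g(2) obtain c t where t: "t \<in> V (Suc (Suc m))" "br g x - \<beta> *s g = c *s e (Suc m) + t"
      by (rule V_split)
    define k :: complex where "k = of_nat m - 1"
    have "k \<noteq> 0" using step of_nat_eq_iff[of m 1, where 'a = complex] by (auto simp: k_def)
    define v where "v = br (e (Suc m)) x - (k + \<beta>) *s e (Suc m)"
    have v: "v \<in> V (Suc (Suc m))" "br (e (Suc m)) x = (k + \<beta>) *s e (Suc m) + v"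
      using br_e_x[OF w, of "Suc m"] step by (auto simp: v_def k_def algebra_simps)
    define h where "h = g - (c / k) *s e (Suc m)"
    have "br h x - \<beta> *s h = (br g x - \<beta> *s g) - (c / k) *s (k *s e (Suc m) + v)"
      by (simp add: h_def v(2) br_linear scale_left_distrib scale_right_distrib scale_right_diff_distrib
          mult.commute)
    also have "\<dots> = t - (c / k) *s v"
      using \<open>k \<noteq> 0\<close> by (simp add: t(2) scale_right_distrib)
    finally have "br h x - \<beta> *s h \<in> V (Suc (Suc m))"
      using t(1) v(1) by (simp add: V_closed)
    moreover have "h - e 2 \<in> V 3"
    proof -
      have "(g - e 2) - (c / k) *s e (Suc m) \<in> V 3"
        using V_closed(2)[OF g(1) V_closed(3)[OF e_in_V[of 3 "Suc m"], of "c / k"]] step by simp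
      then show ?thesis by (simp add: h_def diff_right_commute)
    qed
    ultimately show ?case by blast
  qed
  moreover have "2 \<le> n - 1" "Suc (n - 1) = n" using n_gt by auto
  ultimately show ?thesis
    using that by (metis order_refl)
qed

text \<open>\<open>[e 1, _]\<close> reaches every \<open>e m\<close> with
  \<open>3 \<le> m < n\<close> but not \<open>e n\<close>. Replacing \<open>e 1\<close> by
  \<open>f1\<close> adds only multiples of \<open>e n\<close> here, which the downward induction
  absorbs.\<close>

lemma br_generator_surj_mod_top:
  assumes "f1 - e 1 \<in> V 2" "v \<in> V 3"
  obtains u where "u \<in> V 2" "br f1 u - v \<in> V n"
proof -
  define w where "w = f1 - e 1"
  have w: "w \<in> V 2" "f1 = e 1 + w" using assms(1) by (auto simp: w_def)
  have "\<forall>v \<in> V m. \<exists>u \<in> V 2. br f1 u - v \<in> V n" if "m \<le> n" "3 \<le> m" for m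
    using that
  proof (induction m rule: inc_induct)
    case base
    then show ?case using V_closed(4,5) by (auto intro!: bexI[of _ 0])
  next
    case (step m)
    show ?case
    proof
      fix v assume "v \<in> V m"
      moreover have "m \<le> n" using step by simp
      ultimately obtain c v' where v': "v' \<in> V (Suc m)" "v = c *s e m + v'"
        by (rule V_split)
      have e: "br (e 1) (e (m - 1)) = e m"
        using br_e1_e[of "m - 1"] step by simp
      have we: "br w (e (m - 1)) \<in> V (Suc m)"
        using V_mono[OF _ br_V_V[OF w(1), of "e (m - 1)"], of "Suc m"] step by simp
      then have "v' - c *s br w (e (m - 1)) \<in> V (Suc m)"
        using v'(1) by (simp add: V_closed)
      then obtain u where u: "u \<in> V 2" "br f1 u - (v' - c *s br w (e (m - 1))) \<in> V n"
        using step by auto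
      have "br f1 (c *s e (m - 1) + u) - v = br f1 u - (v' - c *s br w (e (m - 1)))"
        by (simp add: v'(2) w(2) br_linear e scale_right_distrib)
      then show "\<exists>u \<in> V 2. br f1 u - v \<in> V n"
        using u step by (intro bexI[of _ "c *s e (m - 1) + u"]) (auto simp: V_closed)
    qed
  qed
  from this[of 3] show ?thesis
    using that assms(2) n_gt by auto
qed

text \<open>Shifting \<open>x\<close> by an element of the nilradical absorbs the inner part of \<open>[\<cdot>, x]\<close>; what is
  left over are the resonances between equal weights.\<close>

lemma adjusted_generators:
  assumes w: "has_weights x 1 \<beta>"
  obtains f1 f2 u a s r where "f1 - e 1 \<in> V 2" "f2 - e 2 \<in> V 3" "u \<in> N"
    "br f1 (x + u) = f1 + a *s f2 + s *s e n" "br f2 (x + u) = \<beta> *s f2 + r *s e n"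
    "a \<noteq> 0 \<Longrightarrow> \<beta> = 1" "s \<noteq> 0 \<Longrightarrow> of_nat n - 4 + 2 * \<beta> = 1" "r \<noteq> 0 \<Longrightarrow> \<beta> = 4 - of_nat n"
proof -
  define \<omega> where "\<omega> = of_nat n - 4 + 2 * \<beta>"
  obtain g2 where g2: "g2 - e 2 \<in> V 3" "br g2 x - \<beta> *s g2 \<in> V n"
    using eigenvector_mod_top[OF w] by blast
  define v1 where "v1 = br (e 1) x - e 1"
  have v1: "v1 \<in> V 2" "br (e 1) x = e 1 + v1"
    using w by (auto simp: v1_def has_weights_def)
  have "2 \<le> n" using n_gt by simp
  with v1(1) obtain a2 v3 where v3: "v3 \<in> V (Suc 2)" "v1 = a2 *s e 2 + v3"
    by (rule V_split)
  define v2 where "v2 = br (e 2) x - \<beta> *s e 2"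
  have v2: "v2 \<in> V 3" "br (e 2) x = \<beta> *s e 2 + v2"
    using w by (auto simp: v2_def has_weights_def)
  \<comment> \<open>Adding \<open>p\<close> times \<open>e 2\<close> to \<open>e 1\<close> removes
    the coefficient \<open>a2\<close>, unless \<open>e 1\<close> and \<open>e 2\<close> have equal
    weights; then \<open>a2\<close> stays as the resonance \<open>a\<close>.\<close>
  define p where "p = (if \<beta> = 1 then 0 else a2 / (1 - \<beta>))"
  define a where "a = (if \<beta> = 1 then a2 else 0)"
  have pa: "a2 + p * \<beta> - p - a = 0"
    by (auto simp: p_def a_def field_simps)
  define g1 where "g1 = e 1 + p *s e 2"
  have g1: "g1 - e 1 \<in> V 2" using n_gt by (simp add: g1_def V_closed)
  have "br g1 x - g1 - a *s g2 = (a2 + p * \<beta> - p - a) *s e 2 + (v3 + p *s v2 - a *s (g2 - e 2))"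
    by (simp add: g1_def br_linear v1(2) v3(2) v2(2) scale_left_distrib scale_right_distrib
        scale_left_diff_distrib scale_right_diff_distrib)
  then have "br g1 x - g1 - a *s g2 \<in> V 3"
    using v3(1) v2(1) g2(1) unfolding pa by (simp add: V_closed)
  \<comment> \<open>Replacing \<open>x\<close> by \<open>x - u\<close> leaves an error in
    \<open>V n\<close> at \<open>g1\<close>. At \<open>g2\<close> nothing is spoilt, because
    \<open>[g2, u]\<close> lies in \<open>V n\<close>.\<close>
  then obtain u where u: "u \<in> V 2" "br g1 u - (br g1 x - g1 - a *s g2) \<in> V n"
    using br_generator_surj_mod_top[OF g1] by blast
  then obtain s0 where s0: "br g1 u - (br g1 x - g1 - a *s g2) = s0 *s e n"
    using V_top by blast
  have "g2 \<in> V 2"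
    using V_closed(1)[OF V_mono[OF _ g2(1), of 2] e_in_V[of 2 2]] n_gt by simp
  then have "br g2 u \<in> V n" using u(1) by (rule br_V_V)
  then have "br g2 x - \<beta> *s g2 - br g2 u \<in> V n" using g2(2) by (rule V_closed(2)[rotated])
  then obtain r0 where r0: "br g2 x - \<beta> *s g2 - br g2 u = r0 *s e n"
    using V_top by blast
  have uN: "- u \<in> N" using u(1) V2_in_N by (simp add: subspace_neg)
  have g1x: "br g1 (x + - u) = g1 + a *s g2 - s0 *s e n"
    using s0 by (simp add: br_linear algebra_simps)
  have g2x: "br g2 (x + - u) = \<beta> *s g2 + r0 *s e n"
    using r0 by (simp add: br_linear algebra_simps)
  have enx: "br (e n) (x + - u) = \<omega> *s e n"
    using br_e_n_x[OF w] center_right[of "e n" u] V2_in_N[OF u(1)]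
    by (simp add: br_linear \<omega>_def)
  \<comment> \<open>Multiples of \<open>e n\<close> are added next: \<open>\<rho>\<close> to
    \<open>g2\<close> and \<open>\<sigma>\<close> to \<open>g1\<close>. They cancel the remaining
    errors unless the weight \<open>\<omega>\<close> of \<open>e n\<close> equals
    \<open>\<beta>\<close> or \<open>1\<close>, respectively.\<close>
  define \<rho> where "\<rho> = (if \<omega> = \<beta> then 0 else r0 / (\<beta> - \<omega>))"
  define r where "r = (if \<omega> = \<beta> then r0 else 0)"
  have \<rho>: "r0 + \<rho> * \<omega> = \<beta> * \<rho> + r"
    by (auto simp: \<rho>_def r_def field_simps)
  \<comment> \<open>The summand with \<open>a\<close> accounts for the change of \<open>g2\<close>
    inside the image of \<open>g1\<close>.\<close>
  define s1 where "s1 = - s0 - a * \<rho>"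
  define \<sigma> where "\<sigma> = (if \<omega> = 1 then 0 else s1 / (1 - \<omega>))"
  define s where "s = (if \<omega> = 1 then s1 else 0)"
  have \<sigma>: "- s0 + \<sigma> * \<omega> = \<sigma> + a * \<rho> + s"
    by (auto simp: \<sigma>_def s_def s1_def field_simps)
  show ?thesis
  proof
    have "(g1 - e 1) + \<sigma> *s e n \<in> V 2" "(g2 - e 2) + \<rho> *s e n \<in> V 3"
      using g1 g2(1) n_gt by (auto simp: V_closed)
    then show "g1 + \<sigma> *s e n - e 1 \<in> V 2" "g2 + \<rho> *s e n - e 2 \<in> V 3"
      by (simp_all add: algebra_simps)
    show "- u \<in> N" by (rule uN)
    have "br (g1 + \<sigma> *s e n) (x + - u) = g1 + a *s g2 + (- s0 + \<sigma> * \<omega>) *s e n"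
      unfolding br_add_left[of g1] br_scale_left g1x enx
      by (simp add: scale_left_distrib scale_left_diff_distrib)
    then show "br (g1 + \<sigma> *s e n) (x + - u) = g1 + \<sigma> *s e n + a *s (g2 + \<rho> *s e n) + s *s e n"
      unfolding \<sigma> by (simp add: scale_left_distrib scale_right_distrib)
    have "br (g2 + \<rho> *s e n) (x + - u) = \<beta> *s g2 + (r0 + \<rho> * \<omega>) *s e n"
      unfolding br_add_left[of g2] br_scale_left g2x enx by (simp add: scale_left_distrib)
    then show "br (g2 + \<rho> *s e n) (x + - u) = \<beta> *s (g2 + \<rho> *s e n) + r *s e n"
      unfolding \<rho> by (simp add: scale_left_distrib scale_right_distrib)
    show "\<beta> = 1" if "a \<noteq> 0" using that by (simp add: a_def split: if_splits)
    show "of_nat n - 4 + 2 * \<beta> = 1" if "s \<noteq> 0"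
      using that by (simp add: s_def \<omega>_def split: if_splits)
    show "\<beta> = 4 - of_nat n" if "r \<noteq> 0"
      using that by (simp add: r_def \<omega>_def algebra_simps split: if_splits)
  qed
qed

text \<open>The resonance \<open>r\<close> of the second generator is traded for one of the first:
  since \<open>[f 2, f (n - 2)] = f n\<close> and \<open>[f 1, f (n - 2)] = f (n - 1)\<close>,
  subtracting \<open>r\<close> times \<open>f (n - 2)\<close> from the acting element clears
  \<open>r\<close> and creates \<open>t = - r\<close>.\<close>

lemma diagonal_frame:
  assumes w: "has_weights x 1 \<beta>"
  obtains f y u a t s where "g1_basis scale br n f N" "y = x + u" "u \<in> N"
    "\<And>i. i \<in> {1..n} \<Longrightarrow> br (f i) y = lincomb scale n f (diag_table n \<beta> a t s i)"
    "a \<noteq> 0 \<Longrightarrow> \<beta> = 1" "t \<noteq> 0 \<Longrightarrow> \<beta> = 4 - of_nat n" "s \<noteq> 0 \<Longrightarrow> of_nat n - 4 + 2 * \<beta> = 1"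
proof -
  obtain f1 f2 u a s r where f1: "f1 - e 1 \<in> V 2" and f2: "f2 - e 2 \<in> V 3" and u: "u \<in> N"
    and f1x: "br f1 (x + u) = f1 + a *s f2 + s *s e n" and f2x: "br f2 (x + u) = \<beta> *s f2 + r *s e n"
    and res: "a \<noteq> 0 \<Longrightarrow> \<beta> = 1" "s \<noteq> 0 \<Longrightarrow> of_nat n - 4 + 2 * \<beta> = 1" "r \<noteq> 0 \<Longrightarrow> \<beta> = 4 - of_nat n"
    using adjusted_generators[OF w] by blast
  \<comment> \<open>Iterating \<open>[f1, _]\<close> on \<open>f2\<close> supplies the indices
    \<open>2\<close> to \<open>n - 1\<close>; \<open>e n\<close> is not reached this way and is
    kept.\<close>
  define f where "f i = (if i = 1 then f1 else if i = n then e n else (br f1 ^^ (i - 2)) f2)" for i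
  have f_init: "f 1 = f1" "f 2 = f2" "f n = e n" using n_gt by (auto simp: f_def)
  have f_rec: "f (Suc i) = br (f 1) (f i)" if "2 \<le> i" "i \<le> n - 2" for i
  proof -
    have "i \<noteq> 1" "Suc i \<noteq> 1" "i \<noteq> n" "Suc i \<noteq> n" "Suc i - 2 = Suc (i - 2)"
      using that n_gt by auto
    then show ?thesis by (simp add: f_def)
  qed
  have wu: "has_weights (x + u) 1 \<beta>"
    using has_weights_scale_add[OF w u, of 1] by simp
  have enx: "br (e n) (x + u) = (of_nat n - 4 + 2 * \<beta>) *s e n"
    using br_e_n_x[OF wu] by simp
  note hyps = f1[folded f_init(1)] f2[folded f_init(2)] f_init(3) f_rec
    f1x[folded f_init(1,2)] f2x[folded f_init(2)] enx
  have basis: "g1_basis scale br n f N"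
    using eigen_g1_basis[OF hyps] .
  interpret F: g1_ideal scale br n f N
    using basis ideal_left ideal_right n_odd n_gt by unfold_locales
  have n2: "Suc (n - 2) = n - 1" "2 + (n - 2) = n" using n_gt by auto
  define y where "y = x + (u + - r *s f (n - 2))"
  have y: "br v y = br v (x + u) - r *s br v (f (n - 2))" for v
    by (simp add: y_def br_linear)
  have shift: "br (f 1) (f (n - 2)) = f (n - 1)" "br (f 2) (f (n - 2)) = f n"
    using F.br_e1_e[of "n - 2"] F.br_e_e[of 2 "n - 2"] n_gt n2 by (simp_all del: add_2_eq_Suc)
  have shift0: "br (f i) (f (n - 2)) = 0" if "3 \<le> i" "i \<le> n" for i
    using F.br_e_e[of i "n - 2"] that n_gt by auto
  show ?thesis
  proof
    show "g1_basis scale br n f N" by (rule basis)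
    show "y = x + (u + - r *s f (n - 2))" by (rule y_def)
    have "f (n - 2) \<in> N" using n_gt by simp
    then show "u + - r *s f (n - 2) \<in> N"
      using u by (intro subspace_add subspace_scale) auto
    show "br (f i) y = lincomb scale n f (diag_table n \<beta> a (- r) s i)" if i: "i \<in> {1..n}" for i
    proof -
      note lc = lincomb_diag_table[OF n_gt i, of f \<beta> a "- r" s]
      have "i = 1 \<or> i = 2 \<or> 3 \<le> i \<and> i \<le> n - 2 \<or> i = n - 1 \<or> i = n"
        using i unfolding atLeastAtMost_iff by presburger
      then consider "i = 1" | "i = 2" | "3 \<le> i" "i \<le> n - 2" | "i = n - 1" | "i = n" by blast
      then show ?thesis
      proof cases
        case 1
        then show ?thesis using n_gt lc
          by (simp add: y shift hyps(5) f_init(3))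
      next
        case 2
        moreover have "n - 1 \<noteq> 2" using n_gt by simp
        ultimately show ?thesis using n_gt lc
          by (simp add: y shift hyps(6) f_init(3))
      next
        case 3
        then show ?thesis using n_gt lc eigen_weight[OF hyps, of i]
          by (auto simp: y shift0)
      next
        case 4
        then have "of_nat i - 2 = (of_nat n - 3 :: complex)"
          using n_gt by (simp add: of_nat_diff)
        moreover have "n - 1 \<noteq> n" "n - 1 \<noteq> 1" using n_gt by auto
        ultimately show ?thesis using 4 n_gt lc eigen_weight_top[OF hyps]
          by (simp add: y shift0)
      next
        case 5
        moreover have "n \<noteq> n - 1" using n_gt by simp
        ultimately show ?thesis using n_gt lc shift0[of n]
          by (simp add: y f_init(3) enx)
      qed
    qed
    show "- r \<noteq> 0 \<Longrightarrow> \<beta> = 4 - of_nat n" using res by simp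
  qed (use res in auto)
qed

end

context leibniz
begin

lemma lincomb_interval:
  assumes "{l..m} \<subseteq> {1..n}"
  shows "lincomb scale n e (\<lambda>k. if l \<le> k \<and> k \<le> m then c k else 0) = (\<Sum>k\<in>{l..m}. c k *s e k)"
  unfolding lincomb_def using assms by (intro sum.mono_neutral_cong_right) auto

end

section \<open>Squares and the normal forms for nonzero first weight\<close>

context g1_ideal
begin

text \<open>A square is annihilated from the left by everything, which puts it into the span of the
  last two basis vectors. Applying \<open>[x, v] = - [v, x]\<close> to \<open>v = [x, x]\<close>
  gives the second equation.\<close>

lemma square_central:
  assumes w: "has_weights x \<alpha> \<beta>" "\<alpha> \<noteq> 0 \<or> \<beta> \<noteq> 0" and xx: "br x x \<in> N"
  obtains \<delta> \<epsilon> where "br x x = \<delta> *s e (n - 1) + \<epsilon> *s e n"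
    "\<delta> *s br (e (n - 1)) x + \<epsilon> *s br (e n) x = 0"
proof -
  have "br x x \<in> V (n - 1)"
    using xx by (intro center_subset) auto
  moreover have n1: "n - 1 \<le> n" "Suc (n - 1) = n" using n_gt by auto
  ultimately obtain \<delta> t where t: "t \<in> V n" "br x x = \<delta> *s e (n - 1) + t"
    using V_split by metis
  then obtain \<epsilon> where \<epsilon>: "t = \<epsilon> *s e n" using V_top by blast
  have "br (br x x) x = 0"
    using left_mult_eq_neg_right_mult[OF w(1) xx w(2) xx] by simp
  then have "\<delta> *s br (e (n - 1)) x + \<epsilon> *s br (e n) x = 0"
    by (simp add: t(2) \<epsilon> br_linear)
  then show ?thesis using that t(2) \<epsilon> by blast
qed

lemma square_shift_in_N:
  assumes "br x x \<in> N" "u \<in> N"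
  shows "br (c *s x + u) (c *s x + u) \<in> N"
  using assms ideal_left ideal_right
  by (simp add: br_linear subspace_add subspace_scale)

text \<open>The coefficients \<open>\<delta>\<close> and \<open>\<epsilon>\<close> of the square
  survive only at a zero weight, and \<open>a\<close>, \<open>t\<close>, \<open>s\<close> only at
  their resonances. The special values of \<open>\<beta>\<close> are pairwise distinct, so at most
  one parameter remains in each case.\<close>

lemma nonzero_first_weight:
  assumes w: "has_weights x 1 \<beta>" and xx: "br x x \<in> N"
  obtains f y u where "g1_basis scale br n f N" "y = x + u" "u \<in> N"
    "(\<exists>a. x_brackets scale br n f y (R2c n a) (\<lambda>k. 0))
     \<or> (\<exists>\<delta>. x_brackets scale br n f y (R3c n) (\<lambda>k. if k = n - 1 then \<delta> else 0))
     \<or> (\<exists>\<delta>. x_brackets scale br n f y (R4c n) (\<lambda>k. if k = n then \<delta> else 0))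
     \<or> (\<exists>a. x_brackets scale br n f y (R5c n a) (\<lambda>k. 0))
     \<or> (\<exists>a2. x_brackets scale br n f y (R6c n a2) (\<lambda>k. 0))
     \<or> (\<exists>b2. b2 \<notin> {4 - of_nat n, 3 - of_nat n, (4 - of_nat n) / 2, (5 - of_nat n) / 2, 1} \<and>
          x_brackets scale br n f y (R7c n b2) (\<lambda>k. 0))"
proof -
  obtain f y u a t s where basis: "g1_basis scale br n f N" and u: "y = x + u" "u \<in> N"
    and fy: "\<And>i. i \<in> {1..n} \<Longrightarrow> br (f i) y = lincomb scale n f (diag_table n \<beta> a t s i)"
    and res: "a \<noteq> 0 \<Longrightarrow> \<beta> = 1" "t \<noteq> 0 \<Longrightarrow> \<beta> = 4 - of_nat n"
      "s \<noteq> 0 \<Longrightarrow> of_nat n - 4 + 2 * \<beta> = 1"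
    using diagonal_frame[OF w] by blast
  interpret F: g1_ideal scale br n f N
    using basis ideal_left ideal_right n_odd n_gt by unfold_locales
  have wy: "has_weights y 1 \<beta>"
    using has_weights_scale_add[OF w u(2), of 1] u(1) by simp
  have yy: "br y y \<in> N"
    using square_shift_in_N[OF xx u(2), of 1] u(1) by simp
  have yf: "br y (f i) = - br (f i) y" if "i \<in> {1..n}" for i
    using left_mult_eq_neg_right_mult[OF wy yy] that by simp
  have n1: "n - 1 \<noteq> n" "n - 1 \<noteq> 1" "of_nat (n - 1) = (of_nat n - 1 :: complex)" "Suc (n - 1) = n"
    using n_gt by (auto simp: of_nat_diff)
  define m :: complex where "m = of_nat n"
  have f_top: "br (f (n - 1)) y = (m - 3 + \<beta>) *s f (n - 1) + a *s f n"
      "br (f n) y = (m - 4 + 2 * \<beta>) *s f n"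
    using lincomb_diag_table[OF n_gt, of "n - 1" f \<beta> a t s] lincomb_diag_table[OF n_gt, of n f \<beta> a t s]
      fy[of "n - 1"] fy[of n] n_gt n1 by (simp_all add: m_def)
  have wF: "F.has_weights y 1 \<beta>"
  proof -
    have "n - 1 \<noteq> 2" using n_gt by simp
    then have "br (f 1) y - 1 *s f 1 = a *s f 2 + t *s f (n - 1) + s *s f n" "br (f 2) y - \<beta> *s f 2 = 0"
      using lincomb_diag_table[OF n_gt, of 1 f \<beta> a t s] lincomb_diag_table[OF n_gt, of 2 f \<beta> a t s]
        fy[of 1] fy[of 2] n_gt by simp_all
    then show ?thesis
      unfolding F.has_weights_def using n_gt by (simp add: F.V_closed)
  qed
  obtain \<delta> \<epsilon> where yy_eq: "br y y = \<delta> *s f (n - 1) + \<epsilon> *s f n"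
    and ker: "\<delta> *s br (f (n - 1)) y + \<epsilon> *s br (f n) y = 0"
    using F.square_central[OF wF _ yy] by auto
  have ker': "(\<delta> * (m - 3 + \<beta>)) *s f (n - 1) + (\<delta> * a + \<epsilon> * (m - 4 + 2 * \<beta>)) *s f n = 0"
    using ker unfolding f_top
    by (simp add: scale_left_distrib[of "\<delta> * a"] scale_right_distrib add.assoc)
  then have "(\<delta> * (m - 3 + \<beta>)) *s f (n - 1) = - (\<delta> * a + \<epsilon> * (m - 4 + 2 * \<beta>)) *s f n"
    by (simp only: eq_neg_iff_add_eq_0 scale_minus_left)
  also have "\<dots> \<in> F.V n" by (intro F.V_closed(3)) simp
  finally have \<delta>: "\<delta> * (m - 3 + \<beta>) = 0"
    using F.V_coeff_zero[of "\<delta> * (m - 3 + \<beta>)" "n - 1"] n1 n_gt by simp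
  have \<epsilon>: "\<delta> * a + \<epsilon> * (m - 4 + 2 * \<beta>) = 0"
    using ker' F.e_nonzero[of n] n_gt unfolding \<delta> by simp
  \<comment> \<open>These are precisely the values at which two of the special
    \<open>\<beta>\<close> would coincide.\<close>
  have m: "m \<noteq> 1" "m \<noteq> 2" "m \<noteq> 3" "m \<noteq> 4"
    using n_gt of_nat_eq_iff[of n 1, where 'a = complex] of_nat_eq_iff[of n 2, where 'a = complex]
      of_nat_eq_iff[of n 3, where 'a = complex] of_nat_eq_iff[of n 4, where 'a = complex]
    by (auto simp: m_def)
  have xb: "x_brackets scale br n f y (diag_table n \<beta> a t s)
      (\<lambda>k. (if k = n - 1 then \<delta> else 0) + (if k = n then \<epsilon> else 0))"
    using fy yf n_gt unfolding x_brackets_def yy_eq by (simp add: lincomb_add lincomb_delta)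
  have r: "a = 0 \<or> \<beta> = 1" "t = 0 \<or> \<beta> = 4 - m" "s = 0 \<or> m - 4 + 2 * \<beta> = 1"
    using res by (auto simp: m_def)
  consider "\<beta> = 4 - m" | "\<beta> = 3 - m" | "\<beta> * 2 = 4 - m" | "\<beta> * 2 = 5 - m" | "\<beta> = 1"
    | "\<beta> \<noteq> 4 - m" "\<beta> \<noteq> 3 - m" "\<beta> * 2 \<noteq> 4 - m" "\<beta> * 2 \<noteq> 5 - m" "\<beta> \<noteq> 1"
    by blast
  then have "(\<exists>a. x_brackets scale br n f y (R2c n a) (\<lambda>k. 0))
     \<or> (\<exists>\<delta>. x_brackets scale br n f y (R3c n) (\<lambda>k. if k = n - 1 then \<delta> else 0))
     \<or> (\<exists>\<delta>. x_brackets scale br n f y (R4c n) (\<lambda>k. if k = n then \<delta> else 0))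
     \<or> (\<exists>a. x_brackets scale br n f y (R5c n a) (\<lambda>k. 0))
     \<or> (\<exists>a2. x_brackets scale br n f y (R6c n a2) (\<lambda>k. 0))
     \<or> (\<exists>b2. b2 \<notin> {4 - of_nat n, 3 - of_nat n, (4 - of_nat n) / 2, (5 - of_nat n) / 2, 1} \<and>
          x_brackets scale br n f y (R7c n b2) (\<lambda>k. 0))"
  proof cases
    case 1
    have "a = 0" using r(1) 1 m(3) by algebra
    have "s = 0" using r(3) 1 m(3) by algebra
    have "\<delta> = 0" using \<delta> 1 by algebra
    have "\<epsilon> = 0" using \<epsilon> \<open>\<delta> = 0\<close> 1 m(4) by algebra
    note z = \<open>a = 0\<close> \<open>s = 0\<close> \<open>\<delta> = 0\<close> \<open>\<epsilon> = 0\<close>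
    have "x_brackets scale br n f y (R2c n t) (\<lambda>k. 0)"
      using xb unfolding z 1 m_def by (rule x_brackets_cong) (auto simp: diag_table_eq(1) n_gt)
    then show ?thesis by blast
  next
    case 2
    have "a = 0" using r(1) 2 m(2) by algebra
    have "s = 0" using r(3) 2 m(1) by algebra
    have "t = 0" using r(2) 2 by algebra
    have "\<epsilon> = 0" using \<epsilon> \<open>a = 0\<close> 2 m(2) by algebra
    note z = \<open>a = 0\<close> \<open>s = 0\<close> \<open>t = 0\<close> \<open>\<epsilon> = 0\<close>
    have "x_brackets scale br n f y (R3c n) (\<lambda>k. if k = n - 1 then \<delta> else 0)"
      using xb unfolding z 2 m_def by (rule x_brackets_cong) (auto simp: diag_table_eq(2) n_gt)
    then show ?thesis by blast
  next
    case 3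
    have "a = 0" using r(1) 3 m(2) by algebra
    have "s = 0" using r(3) 3 by algebra
    have "t = 0" using r(2) 3 m(4) by algebra
    have "\<delta> = 0" using \<delta> 3 m(2) by algebra
    note z = \<open>a = 0\<close> \<open>s = 0\<close> \<open>t = 0\<close> \<open>\<delta> = 0\<close>
    have b: "\<beta> = (4 - of_nat n) / 2" using 3 by (simp add: m_def field_simps)
    have "x_brackets scale br n f y (R4c n) (\<lambda>k. if k = n then \<epsilon> else 0)"
      using xb unfolding z b by (rule x_brackets_cong) (auto simp: diag_table_eq(3) n_gt)
    then show ?thesis by blast
  next
    case 4
    have "a = 0" using r(1) 4 m(3) by algebra
    have "t = 0" using r(2) 4 m(3) by algebra
    have "\<delta> = 0" using \<delta> 4 m(1) by algebra
    have "\<epsilon> = 0" using \<epsilon> \<open>a = 0\<close> 4 by algebra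
    note z = \<open>a = 0\<close> \<open>t = 0\<close> \<open>\<delta> = 0\<close> \<open>\<epsilon> = 0\<close>
    have b: "\<beta> = (5 - of_nat n) / 2" using 4 by (simp add: m_def field_simps)
    have "x_brackets scale br n f y (R5c n s) (\<lambda>k. 0)"
      using xb unfolding z b by (rule x_brackets_cong) (auto simp: diag_table_eq(4) n_gt)
    then show ?thesis by blast
  next
    case 5
    have "s = 0" using r(3) 5 m(3) by algebra
    have "t = 0" using r(2) 5 m(3) by algebra
    have "\<delta> = 0" using \<delta> 5 m(2) by algebra
    have "\<epsilon> = 0" using \<epsilon> \<open>\<delta> = 0\<close> 5 m(2) by algebra
    note z = \<open>s = 0\<close> \<open>t = 0\<close> \<open>\<delta> = 0\<close> \<open>\<epsilon> = 0\<close>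
    have "x_brackets scale br n f y (R6c n a) (\<lambda>k. 0)"
      using xb unfolding z 5 by (rule x_brackets_cong) (auto simp: diag_table_eq(5) n_gt)
    then show ?thesis by blast
  next
    case 6
    have "s = 0" using r(3) 6(4) by algebra
    have "t = 0" using r(2) 6(1) by algebra
    have "a = 0" using r(1) 6(5) by algebra
    have "\<delta> = 0" using \<delta> 6(2) by algebra
    have "\<epsilon> = 0" using \<epsilon> \<open>\<delta> = 0\<close> 6(3) by algebra
    note z = \<open>s = 0\<close> \<open>t = 0\<close> \<open>a = 0\<close> \<open>\<delta> = 0\<close> \<open>\<epsilon> = 0\<close>
    have "x_brackets scale br n f y (R7c n \<beta>) (\<lambda>k. 0)"
      using xb unfolding z by (rule x_brackets_cong) (auto simp: diag_table_eq(6) n_gt)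
    moreover have "\<beta> \<notin> {4 - of_nat n, 3 - of_nat n, (4 - of_nat n) / 2, (5 - of_nat n) / 2, 1}"
      using 6 by (auto simp: m_def)
    ultimately show ?thesis by blast
  qed
  with basis u show ?thesis by (rule that)
qed

section \<open>Vanishing first weight\<close>

text \<open>Bracketing with \<open>e 1\<close> shifts \<open>[e 2, y]\<close> index by index; the
  term \<open>a\<close> contributes only at the end, through \<open>[e 2, e (n - 2)] = e n\<close>.
  Differentiating \<open>[e 2, e j] = 0\<close> for \<open>j = n - 2 * k\<close> gives the
  coefficient \<open>b (2 * k)\<close> twice with the same sign, so it vanishes. For odd indices the
  signs are opposite and no condition arises.\<close>

lemma zero_first_weight_table:
  assumes e1y: "br (e 1) y = a *s e 2"
    and e2y: "br (e 2) y = e 2 + (\<Sum>t\<in>{4..n - 1}. b t *s e t)"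
    and eny: "br (e n) y = 2 *s e n"
  shows "i \<in> {1..n} \<Longrightarrow> br (e i) y = lincomb scale n e (R1c n a b i)"
    and "2 \<le> k \<Longrightarrow> k \<le> (n - 3) div 2 \<Longrightarrow> b (2 * k) = 0"
proof -
  have mid: "br (e i) y = e i + (\<Sum>t\<in>{i + 2..n - 1}. b (t - i + 2) *s e t)"
    if "2 \<le> i" "i \<le> n - 2" for i
    using that
  proof (induction i rule: dec_induct)
    case base
    have "(\<Sum>t\<in>{4..n - 1}. b t *s e t) = (\<Sum>t\<in>{4..n - 1}. b (t - 2 + 2) *s e t)"
      by (intro sum.cong refl arg_cong2[of _ _ _ _ scale] arg_cong[of _ _ b]) auto
    then show ?case by (simp add: e2y)
  next
    case (step i)
    have ei: "e (Suc i) = br (e 1) (e i)" using br_e1_e[of i] step by simp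
    have "br (e 1) (e t) = (if t \<le> n - 2 then e (Suc t) else 0)" if "t \<in> {i + 2..n - 1}" for t
    proof (cases "t \<le> n - 2")
      case False
      then have "t = n - 1" using that by auto
      then show ?thesis using br_e1_top[of t] False by simp
    qed (use that br_e1_e[of t] in auto)
    then have "(\<Sum>t\<in>{i + 2..n - 1}. b (t - i + 2) *s br (e 1) (e t)) =
        (\<Sum>t\<in>{i + 2..n - 2}. b (t - i + 2) *s e (Suc t))"
      by (intro sum.mono_neutral_cong_right) auto
    also have "\<dots> = (\<Sum>t\<in>{Suc (i + 2)..Suc (n - 2)}. b (t - Suc i + 2) *s e t)"
      unfolding sum.shift_bounds_cl_Suc_ivl by simp
    also have "{Suc (i + 2)..Suc (n - 2)} = {Suc i + 2..n - 1}" using n_gt by auto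
    finally have shift: "(\<Sum>t\<in>{i + 2..n - 1}. b (t - i + 2) *s br (e 1) (e t)) =
        (\<Sum>t\<in>{Suc i + 2..n - 1}. b (t - Suc i + 2) *s e t)" .
    have "2 + i \<noteq> n" using step by simp
    then have "br (e 2) (e i) = 0" using step by (simp add: br_e_e)
    moreover have "br (e (Suc i)) y = br (e 1) (br (e i) y) + br (br (e 1) y) (e i)"
      unfolding ei by (rule right_mult_derivation)
    ultimately show ?case
      using step shift by (simp add: br_linear br_sum_right e1y ei)
  qed
  have n2: "Suc (n - 2) = n - 1" "2 + (n - 2) = n" using n_gt by auto
  have top: "br (e (n - 1)) y = e (n - 1) + a *s e n"
  proof -
    have e: "e (n - 1) = br (e 1) (e (n - 2))" using br_e1_e[of "n - 2"] n_gt n2 by simp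
    have "br (e (n - 2)) y = e (n - 2)" using mid[of "n - 2"] n_gt by simp
    moreover have "br (e 2) (e (n - 2)) = e n" using n_gt n2 by (simp add: br_e_e del: add_2_eq_Suc)
    moreover have "br (e (n - 1)) y = br (e 1) (br (e (n - 2)) y) + br (br (e 1) y) (e (n - 2))"
      unfolding e by (rule right_mult_derivation)
    ultimately show ?thesis by (simp add: e e1y br_linear)
  qed
  show "br (e i) y = lincomb scale n e (R1c n a b i)" if i: "i \<in> {1..n}" for i
  proof -
    have "i = 1 \<or> 2 \<le> i \<and> i \<le> n - 2 \<or> i = n - 1 \<or> i = n"
      using i unfolding atLeastAtMost_iff by presburger
    then consider "i = 1" | "2 \<le> i" "i \<le> n - 2" | "i = n - 1" | "i = n" by blast
    then show ?thesis
    proof cases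
      case 1
      have "lincomb scale n e (R1c n a b i) = a *s e 2"
        using 1 n_gt by (intro lincomb_single) (auto simp: R1c_def)
      then show ?thesis using 1 e1y by simp
    next
      case 2
      have "R1c n a b i k = (if k = i then 1 else 0) + (if i + 2 \<le> k \<and> k \<le> n - 1 then b (k - i + 2) else 0)" for k
        using 2 by (simp add: R1c_def)
      then have "lincomb scale n e (R1c n a b i) =
          e i + (\<Sum>t\<in>{i + 2..n - 1}. b (t - i + 2) *s e t)"
        using i by (subst ext[of "R1c n a b i"])
          (auto simp: lincomb_add lincomb_delta lincomb_interval)
      then show ?thesis using mid[OF 2] by simp
    next
      case 3
      have "lincomb scale n e (R1c n a b i) = 1 *s e (n - 1) + a *s e n"
        using 3 n_gt by (intro lincomb_double) (auto simp: R1c_def)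
      then show ?thesis using 3 top by simp
    next
      case 4
      have "lincomb scale n e (R1c n a b i) = 2 *s e n"
        using 4 n_gt by (intro lincomb_single) (auto simp: R1c_def)
      then show ?thesis using 4 eny by simp
    qed
  qed
  show "b (2 * k) = 0" if k: "2 \<le> k" "k \<le> (n - 3) div 2" for k
  proof -
    \<comment> \<open>\<open>e j\<close> pairs with \<open>e (2 * k)\<close>, and \<open>e 2\<close>
      with \<open>e (n - 2)\<close>; the bounds on \<open>k\<close> put \<open>n - 2\<close> and
      \<open>2 * k\<close> inside the two summation ranges.\<close>
    define j where "j = n - 2 * k"
    have "2 * k \<le> n - 3" using k by linarith
    then have j: "3 \<le> j" "j + 2 \<le> n - 2" "2 * k + j = n" "n - 2 - j + 2 = 2 * k" "2 + j \<noteq> n"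
      using k n_gt by (auto simp: j_def)
    have "br (e 2) (br (e j) y) = (\<Sum>t\<in>{j + 2..n - 1}. b (t - j + 2) *s br (e 2) (e t))"
      using j mid[of j] by (simp add: br_linear br_sum_right br_e_e)
    also have "\<dots> = (\<Sum>t\<in>{j + 2..n - 1}. if t = n - 2 then b (2 * k) *s e n else 0)"
      using j by (intro sum.cong) (auto simp: br_e_e)
    also have "\<dots> = b (2 * k) *s e n" using j by auto
    finally have 1: "br (e 2) (br (e j) y) = b (2 * k) *s e n" .
    have "br (br (e 2) y) (e j) = (\<Sum>t\<in>{4..n - 1}. b t *s br (e t) (e j))"
      using j by (simp add: e2y br_linear br_sum_left br_e_e)
    also have "\<dots> = (\<Sum>t\<in>{4..n - 1}. if t = 2 * k then b (2 * k) *s e n else 0)"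
      using j by (intro sum.cong) (auto simp: br_e_e)
    also have "\<dots> = b (2 * k) *s e n" using j k by auto
    finally have 2: "br (br (e 2) y) (e j) = b (2 * k) *s e n" .
    have "br (e 2) (e j) = 0" using j by (auto simp: br_e_e)
    then have "b (2 * k) *s e n + b (2 * k) *s e n = 0"
      using right_mult_derivation[of "e 2" "e j" y] 1 2 by simp
    then have "(2 * b (2 * k)) *s e n = 0"
      by (simp add: scale_left_distrib[symmetric])
    then show ?thesis using e_nonzero[of n] n_gt by simp
  qed
qed

lemma V_sum:
  assumes "u \<in> V m" "1 \<le> m"
  obtains c where "u = (\<Sum>t\<in>{m..n}. c t *s e t)"
proof -
  have "u \<in> range (\<lambda>c. \<Sum>v\<in>e ` {m..n}. c v *s v)"
    using assms(1) unfolding V_def by (simp add: span_finite)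
  then obtain c where "u = (\<Sum>v\<in>e ` {m..n}. c v *s v)" by blast
  moreover have "inj_on e {m..n}"
    using inj assms(2) by (auto elim: inj_on_subset)
  ultimately have "u = (\<Sum>t\<in>{m..n}. c (e t) *s e t)"
    by (simp add: sum.reindex)
  then show ?thesis by (rule that)
qed

text \<open>Multiples of \<open>e n\<close> are central in \<open>N\<close> and do not change
  brackets. Only the generators \<open>e 1\<close> and \<open>e 2\<close> are moved, since the other
  basis vectors are themselves brackets.\<close>

lemma central_shift_basis:
  assumes z: "\<And>i. z i \<in> V n" "\<And>i. 3 \<le> i \<Longrightarrow> z i = 0"
  shows "g1_basis scale br n (\<lambda>i. e i + z i) N"
proof -
  have zV: "z i \<in> V (Suc i)" if "1 \<le> i" "i \<le> n" for i
    using z that V_mono[of "Suc i" n] n_gt V_closed(5) by (cases "i \<le> 2") auto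
  have center: "z i \<in> V (n - 1)" "z i \<in> N" for i
    using V_mono[OF _ z(1), of "n - 1"] V_in_N[OF _ z(1)] n_gt by auto
  have br_eq: "br (e i + z i) (e j + z j) = br (e i) (e j)"
    if "i \<in> {1..n}" "j \<in> {1..n}" for i j
    using that center center_left center_right by (simp add: br_linear)
  have tri: "(e i + z i) - e i \<in> V (Suc i)" if "1 \<le> i" "i \<le> n" for i
    using zV that by simp
  show ?thesis
  proof (rule g1_basisI[OF n_odd n_gt triangular_frame[OF tri]])
    fix i assume i: "2 \<le> i" "i \<le> n - 2"
    then show "br (e 1 + z 1) (e i + z i) = e (i + 1) + z (i + 1)"
      using br_eq[of 1 i] br_e1_e[OF i] z(2)[of "Suc i"] by (simp flip: Suc_eq_plus1)
  next
    fix i j assume "i \<in> {2..n}" "j \<in> {2..n}"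
    then show "br (e i + z i) (e j + z j) = (if i + j = n then (- 1) ^ i *s (e n + z n) else 0)"
      using br_eq[of i j] br_e_e[of i j] z(2)[of n] n_gt by simp
  next
    fix i j assume "i \<in> {1..n}" "j \<in> {1..n}"
    then show "br (e j + z j) (e i + z i) = - br (e i + z i) (e j + z j)"
      using br_eq[of i j] br_eq[of j i] br_e_skew[of j i] by simp
  qed (use br_eq[of 1 "n - 1"] br_eq[of 1 n] br_e1_top n_gt in auto)
qed

text \<open>The weights are \<open>0\<close> on \<open>e 1\<close>, \<open>1\<close> on
  \<open>e 2\<close> to \<open>e (n - 1)\<close>, and \<open>2\<close> on \<open>e n\<close>. Shifts
  of \<open>x\<close> clear the part of \<open>[e 1, x]\<close> in \<open>V 3\<close> modulo
  \<open>e n\<close> and the \<open>e 3\<close>-term of \<open>[e 2, x]\<close>; the remaining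
  multiples of \<open>e n\<close> are absorbed because the weight \<open>2\<close> differs from
  \<open>0\<close> and \<open>1\<close>.\<close>

lemma zero_first_weight:
  assumes w: "has_weights x 0 1" and xx: "br x x \<in> N"
  obtains f y u a b where "g1_basis scale br n f N" "y = x + u" "u \<in> N"
    "\<And>k. 2 \<le> k \<Longrightarrow> k \<le> (n - 3) div 2 \<Longrightarrow> b (2 * k) = 0"
    "x_brackets scale br n f y (R1c n a b) (\<lambda>k. 0)"
proof -
  have n2: "2 \<le> n" and n34: "e 3 \<in> N" "3 \<le> n" using n_gt by auto
  have "br (e 1) x \<in> V 2" using w by (simp add: has_weights_def)
  then obtain a v3 where v3: "v3 \<in> V (Suc 2)" "br (e 1) x = a *s e 2 + v3"
    using n2 by (rule V_split)
  then obtain u where u: "u \<in> V 2" "br (e 1) u - v3 \<in> V n"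
    using br_generator_surj_mod_top[of "e 1" v3] V_closed(5) by auto
  then obtain s0 where s0: "br (e 1) u - v3 = s0 *s e n" using V_top by blast
  have uN: "- u \<in> N" using u(1) V2_in_N by (simp add: subspace_neg)
  define x1 where "x1 = x + - u"
  have w1: "has_weights x1 0 1"
    using has_weights_scale_add[OF w uN, of 1] by (simp add: x1_def)
  have "br (e 2) x1 - e 2 \<in> V 3" using w1 by (simp add: has_weights_def)
  then obtain b3 v4 where v4: "v4 \<in> V (Suc 3)" "br (e 2) x1 - e 2 = b3 *s e 3 + v4"
    using n34(2) by (rule V_split)
  obtain b where b: "v4 = (\<Sum>t\<in>{4..n}. b t *s e t)"
    using v4(1) V_sum[of v4 4] by auto
  \<comment> \<open>\<open>[e 2, e 1] = - e 3\<close> cancels the term \<open>b3\<close>, and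
    \<open>[e 1, e 1] = 0\<close> leaves the image of \<open>e 1\<close> alone.\<close>
  define y where "y = x1 + b3 *s e 1"
  \<comment> \<open>The shift \<open>c\<close> of \<open>e 1\<close> solves
    \<open>2 * c - s0 = - a * b n\<close>, where the right-hand side comes from the change of
    \<open>e 2\<close>; the shift \<open>d\<close> of \<open>e 2\<close> solves
    \<open>b n + 2 * d = d\<close>.\<close>
  define z where "z = (\<lambda>i::nat. if i = 1 then ((s0 - a * b n) / 2) *s e n else if i = 2 then (- b n) *s e n else 0)"
  define f where "f = (\<lambda>i. e i + z i)"
  have basis: "g1_basis scale br n f N"
    unfolding f_def by (intro central_shift_basis) (auto simp: z_def V_closed)
  have uN': "b3 *s e 1 - u \<in> N"
    using uN n_gt subspace_add[OF subspace_N uN subspace_scale[OF subspace_N e_in_N[of 1], of b3]] by simp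
  have y: "y = x + (b3 *s e 1 - u)" by (simp add: y_def x1_def)
  have wy: "has_weights y 0 1"
    using has_weights_scale_add[OF w uN', of 1] by (simp add: y)
  have yy: "br y y \<in> N"
    using square_shift_in_N[OF xx uN', of 1] by (simp add: y)
  interpret F: g1_ideal scale br n f N
    using basis ideal_left ideal_right n_odd n_gt by unfold_locales
  have f_e: "f i = e i" if "3 \<le> i" for i using that by (simp add: f_def z_def)
  have f1: "f 1 = e 1 + ((s0 - a * b n) / 2) *s e n" and f2: "f 2 = e 2 - b n *s e n"
    by (simp_all add: f_def z_def)
  have eny: "br (e n) y = 2 *s e n" using br_e_n_x[OF wy] by simp
  have e1y: "br (e 1) y = a *s e 2 - s0 *s e n"
    using s0 by (simp add: y_def x1_def br_linear v3(2) algebra_simps)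
  have e21: "br (e 2) (e 1) = - e 3" using br_e_e1[of 2] n_gt by simp
  have e2y: "br (e 2) y = e 2 + v4"
    using v4(2) by (simp add: y_def br_add_right br_scale_right e21 algebra_simps)
  have top: "{4..n} = insert n {4..n - 1}" using n_gt by auto
  have v4_eq: "v4 = (\<Sum>t\<in>{4..n - 1}. b t *s e t) + b n *s e n"
    unfolding b top using n_gt by (subst sum.insert) (auto simp: add.commute)
  have sum_f: "(\<Sum>t\<in>{4..n - 1}. b t *s f t) = (\<Sum>t\<in>{4..n - 1}. b t *s e t)"
    by (intro sum.cong) (auto simp: f_e)
  have f1y: "br (f 1) y = a *s f 2"
  proof -
    have "br (f 1) y = a *s e 2 + (- s0 + ((s0 - a * b n) / 2) * 2) *s e n"
      by (simp only: f1 br_add_left br_scale_left e1y eny) (simp add: scale_left_distrib scale_left_diff_distrib)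
    also have "- s0 + ((s0 - a * b n) / 2) * 2 = - (a * b n)" by (simp add: field_simps)
    finally show ?thesis by (simp add: f2 scale_right_diff_distrib)
  qed
  have f2y: "br (f 2) y = f 2 + (\<Sum>t\<in>{4..n - 1}. b t *s f t)"
  proof -
    have "b n *s e n - (b n * 2) *s e n = - (b n *s e n)"
      by (simp flip: scale_left_diff_distrib)
    then have "br (f 2) y = e 2 + (\<Sum>t\<in>{4..n - 1}. b t *s e t) - b n *s e n"
      by (simp only: f2 br_diff_left br_scale_left e2y eny v4_eq) (simp add: add_diff_eq[symmetric])
    then show ?thesis by (simp add: f2 sum_f)
  qed
  have fny: "br (f n) y = 2 *s f n" using eny f_e n_gt by simp
  note table = F.zero_first_weight_table[OF f1y f2y fny]
  have wF: "F.has_weights y 0 1"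
  proof -
    have "(\<Sum>t\<in>{4..n - 1}. b t *s f t) \<in> F.V 3"
      by (intro subspace_sum F.subspace_V subspace_scale) auto
    then show ?thesis
      unfolding F.has_weights_def f1y f2y using n_gt by (simp add: F.V_closed)
  qed
  \<comment> \<open>The last two weights are \<open>1\<close> and \<open>2\<close>, so
    \<open>[_, y]\<close> has no kernel in which the square could lie.\<close>
  have "br y y = 0"
  proof (rule F.center_kernel_zero[OF wF])
    show "br y y \<in> F.V (n - 1)" using yy by (intro F.center_subset) auto
    show "br (br y y) y = 0"
      using left_mult_eq_neg_right_mult[OF wy yy _ yy] by simp
  qed auto
  moreover have "br y (f i) = - br (f i) y" if "i \<in> {1..n}" for i
    using left_mult_eq_neg_right_mult[OF wy yy] that by simp
  ultimately have "x_brackets scale br n f y (R1c n a b) (\<lambda>k. 0)"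
    using table(1) by (simp add: x_brackets_def lincomb_zero)
  with basis y uN' table(2) show ?thesis by (rule that)
qed

section \<open>Classification\<close>

text \<open>With zero diagonal \<open>x\<close> also acts strictly triangularly, so the flag with
  the whole algebra on top drops one step under every right multiplication. The first drop, into
  \<open>N\<close>, uses \<open>[x, x] \<in> N\<close>.\<close>

lemma nilpotent_if_weights_zero:
  assumes w: "has_weights x 0 0" and xx: "br x x \<in> N"
    and gen: "\<And>y. \<exists>c u. u \<in> N \<and> y = c *s x + u"
  shows "nilpotent_set scale br UNIV"
proof -
  \<comment> \<open>\<open>V 0\<close> would involve the arbitrary value \<open>e 0\<close>; index
    \<open>0\<close> stands for the whole algebra instead.\<close>
  define F where "F = (\<lambda>i. if i = 0 then UNIV else V i)"
  show ?thesis
  proof (rule nilpotent_if_filtration[of F "Suc n"])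
    show "y \<in> F 0" for y by (simp add: F_def)
    show "subspace (F i)" for i by (simp add: F_def)
    show "F (Suc n) = {0}" by (simp add: F_def V_empty)
    show "br u y \<in> F (Suc i)" if "u \<in> F i" for i u y
    proof -
      obtain c y' where y: "y' \<in> N" "y = c *s x + y'" using gen by blast
      consider "i = 0" | "i = 1" | "2 \<le> i" by linarith
      then show ?thesis
      proof cases
        case 1
        obtain d u' where u: "u' \<in> N" "u = d *s x + u'" using gen by blast
        have "br u y \<in> N"
          using xx ideal_left ideal_right u(1) y(1)
          by (simp add: u(2) y(2) br_linear subspace_add subspace_scale)
        then show ?thesis using 1 V_one by (simp add: F_def flip: One_nat_def)
      next
        case 2
        then have uV: "u \<in> V 1" using that by (simp add: F_def)
        then obtain d v where v: "v \<in> V 2" "u = d *s e 1 + v" using N_split V_one by blast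
        have "br u y' \<in> V 2"
          using br_e1_N[OF y(1)] br_V_N[OF v(1) _ y(1)] V_mono[of 2 3]
          by (simp add: v(2) br_linear V_closed)
        moreover have "br u x \<in> V 2"
          using br_V_x_nil[OF w _ _ uV] by (simp add: Suc_1)
        ultimately show ?thesis using 2 by (simp add: F_def y(2) br_linear V_closed Suc_1)
      next
        case 3
        then have uV: "u \<in> V i" using that by (simp add: F_def)
        then have "br u y' \<in> V (Suc i)" "br u x \<in> V (Suc i)"
          using br_V_N[OF uV 3 y(1)] br_V_x_nil[OF w _ _ uV] 3 by auto
        then show ?thesis by (simp add: F_def y(2) br_linear V_closed)
      qed
    qed
  qed
qed

text \<open>Writing \<open>[x, x] = c x + u\<close> with \<open>u \<in> N\<close>, the identity
  \<open>[x, [x, x]] = 0\<close> puts \<open>c * c\<close> times \<open>x\<close> into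
  \<open>N\<close>, hence \<open>c = 0\<close>.\<close>

lemma square_in_N:
  assumes gen: "\<And>y. \<exists>c u. u \<in> N \<and> y = c *s x + u" and "x \<notin> N"
  shows "br x x \<in> N"
proof -
  obtain c u where u: "u \<in> N" "br x x = c *s x + u" using gen by blast
  have "c *s br x x + br x u = 0"
    using br_square_right[of x x] by (simp add: u(2) br_linear)
  then have "(c * c) *s x + (c *s u + br x u) = 0"
    by (simp add: u(2) scale_right_distrib add.assoc)
  then have "(c * c) *s x = - (c *s u + br x u)"
    by (simp only: eq_neg_iff_add_eq_0)
  also have "\<dots> \<in> N"
    using u(1) ideal_right by (intro subspace_neg subspace_add subspace_scale) auto
  finally have cN: "(c * c) *s x \<in> N" .
  have "c = 0"
  proof (rule ccontr)
    assume "c \<noteq> 0"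
    then show False
      using subspace_scale[OF subspace_N cN, of "1 / (c * c)"] \<open>x \<notin> N\<close> by simp
  qed
  then show ?thesis using u by simp
qed

end

theorem theorem3p2:
  fixes scale :: "complex \<Rightarrow> 'a::ab_group_add \<Rightarrow> 'a"
    and br :: "'a \<Rightarrow> 'a \<Rightarrow> 'a"
    and n :: nat and N :: "'a set"
  assumes "odd n" and "n > 5"
    and "leibniz_algebra scale br"
    and "vector_space.dim scale (UNIV :: 'a set) = n + 1"
    and "solvable_alg scale br"
    and "is_nilradical scale br N"
    and "\<exists>f. g1_basis scale br n f N"
  shows "\<exists>e x. g1_basis scale br n e N \<and> x \<notin> e ` {1..n} \<and>
           \<not> module.dependent scale (insert x (e ` {1..n})) \<and>
           module.span scale (insert x (e ` {1..n})) = UNIV \<and>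
           ((\<exists>a2 b. (\<forall>k. 2 \<le> k \<and> k \<le> (n - 3) div 2 \<longrightarrow> b (2 * k) = 0) \<and>
                    x_brackets scale br n e x (R1c n a2 b) (\<lambda>k. 0))
          \<or> (\<exists>a. x_brackets scale br n e x (R2c n a) (\<lambda>k. 0))
          \<or> (\<exists>\<delta>. x_brackets scale br n e x (R3c n) (\<lambda>k. if k = n - 1 then \<delta> else 0))
          \<or> (\<exists>\<delta>. x_brackets scale br n e x (R4c n) (\<lambda>k. if k = n then \<delta> else 0))
          \<or> (\<exists>a. x_brackets scale br n e x (R5c n a) (\<lambda>k. 0))
          \<or> (\<exists>a2. x_brackets scale br n e x (R6c n a2) (\<lambda>k. 0))
          \<or> (\<exists>b2. b2 \<notin> {4 - of_nat n, 3 - of_nat n, (4 - of_nat n) / 2, (5 - of_nat n) / 2, 1} \<and>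
                  x_brackets scale br n e x (R7c n b2) (\<lambda>k. 0)))"
proof -
  obtain e where e: "g1_basis scale br n e N" using assms(7) by blast
  interpret vector_space scale
    using assms(3) by (simp add: leibniz_algebra_def)
  interpret leibniz scale br
    using assms(3) by unfold_locales (auto simp: leibniz_algebra_def)
  have lN: "lideal scale br N" using assms(6) by (simp add: is_nilradical_def)
  interpret g1_ideal scale br n e N
    using e assms(1,2) lN by unfold_locales (auto simp: lideal_def)
  obtain B where B: "independent B" "span B = UNIV" "card B = n + 1"
    using basis_exists[of UNIV] assms(4) by (metis subset_UNIV top.extremum_unique)
  have finB: "finite B" using B(3) card.infinite by fastforce
  have basis_bound: "card C \<le> n + 1" if "independent C" "finite C" for C
    using independent_span_bound[OF finB that(1)] B(3) by (simp add: B(2))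
  \<comment> \<open>By the dimension any vector outside \<open>N\<close> completes any frame of
    \<open>N\<close> to a basis. Both are kept general because the normalisations change the frame
    and the vector.\<close>
  have extend: "x \<notin> f ` {1..n}" "independent (insert x (f ` {1..n}))"
      "span (insert x (f ` {1..n})) = UNIV"
    if f: "g1_basis scale br n f N" and x: "x \<notin> N" for f x
  proof -
    have fN: "span (f ` {1..n}) = N" "independent (f ` {1..n})" "inj_on f {1..n}"
      using f by (auto simp: g1_basis_def)
    have notin: "x \<notin> f ` {1..n}" using x fN(1) span_base[of x "f ` {1..n}"] by metis
    have ind: "independent (insert x (f ` {1..n}))"
      using x fN by (simp add: independent_insertI)
    have card_x: "card (insert x (f ` {1..n})) = n + 1"
      using notin fN(3) by (simp add: card_image)
    have "v \<in> span (insert x (f ` {1..n}))" for v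
    proof (rule ccontr)
      assume v: "v \<notin> span (insert x (f ` {1..n}))"
      then have "independent (insert v (insert x (f ` {1..n})))"
        using ind by (rule independent_insertI)
      moreover have "v \<notin> insert x (f ` {1..n})"
        using v span_base[of v "insert x (f ` {1..n})"] by metis
      ultimately show False
        using basis_bound[of "insert v (insert x (f ` {1..n}))"] card_x by simp
    qed
    then have "UNIV = span (insert x (f ` {1..n}))" by (rule UNIV_eq_I)
    with notin ind show "x \<notin> f ` {1..n}" "independent (insert x (f ` {1..n}))"
      "span (insert x (f ` {1..n})) = UNIV" by simp_all
  qed
  have "N \<noteq> UNIV"
  proof
    assume "N = UNIV"
    then have "card (e ` {1..n}) = dim (UNIV :: 'a set)"
      using indep V_one dim_span_eq_card_independent[OF indep] by (simp add: V_def)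
    then show False using inj assms(4) by (simp add: card_image)
  qed
  then obtain x0 where x0: "x0 \<notin> N" by blast
  have gen: "\<exists>c u. u \<in> N \<and> y = scale c x + u" if "x \<notin> N" for x y
  proof -
    have "y \<in> span (insert x (e ` {1..n}))" using extend(3)[OF e that] by simp
    then obtain c where "y - scale c x \<in> span (e ` {1..n})"
      unfolding span_breakdown_eq by blast
    then show ?thesis
      using V_one by (intro exI[of _ c] exI[of _ "y - scale c x"]) (simp add: V_def)
  qed
  obtain \<alpha> \<beta> where w0: "has_weights x0 \<alpha> \<beta>" by (rule has_weights_exist)
  have shift_notin: "scale c x0 + u \<notin> N" if "c \<noteq> 0" "u \<in> N" for c u
  proof
    assume "scale c x0 + u \<in> N"
    then have "scale (1 / c) ((scale c x0 + u) - u) \<in> N"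
      using that by (intro subspace_scale subspace_diff) auto
    then show False using that x0 by simp
  qed
  show ?thesis
  proof (cases "\<alpha> = 0")
    case True
    \<comment> \<open>Otherwise the whole algebra would be a nilpotent ideal strictly containing
      \<open>N\<close>.\<close>
    have "\<beta> \<noteq> 0"
    proof
      assume "\<beta> = 0"
      then have "nilpotent_set scale br UNIV"
        using nilpotent_if_weights_zero[OF _ square_in_N[OF gen[OF x0] x0] gen[OF x0]] w0 True by simp
      moreover have "lideal scale br UNIV" by (simp add: lideal_def)
      ultimately show False
        using assms(6) \<open>N \<noteq> UNIV\<close> by (auto simp: is_nilradical_def)
    qed
    define x where "x = scale (1 / \<beta>) x0"
    have "has_weights x 0 1"
      using has_weights_scale_add[OF w0, of 0 "1 / \<beta>"] True \<open>\<beta> \<noteq> 0\<close> subspace_0[OF subspace_N] by (simp add: x_def)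
    moreover have xN: "x \<notin> N"
      using shift_notin[of "1 / \<beta>" 0] \<open>\<beta> \<noteq> 0\<close> subspace_0[OF subspace_N] by (simp add: x_def)
    have "br x x \<in> N" by (rule square_in_N[OF gen[OF xN] xN])
    ultimately show ?thesis
    proof (rule zero_first_weight)
      fix f y u a b
      assume f: "g1_basis scale br n f N" "y = x + u" "u \<in> N"
        "x_brackets scale br n f y (R1c n a b) (\<lambda>k. 0)"
        and b: "\<And>k. 2 \<le> k \<Longrightarrow> k \<le> (n - 3) div 2 \<Longrightarrow> b (2 * k) = 0"
      have "y \<notin> N" using shift_notin[of "1 / \<beta>" u] f(2,3) \<open>\<beta> \<noteq> 0\<close> by (simp add: x_def)
      note ext = extend[OF f(1) this]
      show ?thesis
        using f(1,4) b ext by (intro exI[of _ f] exI[of _ y] conjI disjI1 exI[of _ a] exI[of _ b]) simp_all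
    qed
  next
    case False
    define x where "x = scale (1 / \<alpha>) x0"
    have "has_weights x 1 (\<beta> / \<alpha>)"
      using has_weights_scale_add[OF w0, of 0 "1 / \<alpha>"] False subspace_0[OF subspace_N] by (simp add: x_def)
    moreover have xN: "x \<notin> N"
      using shift_notin[of "1 / \<alpha>" 0] False subspace_0[OF subspace_N] by (simp add: x_def)
    have "br x x \<in> N" by (rule square_in_N[OF gen[OF xN] xN])
    ultimately show ?thesis
    proof (rule nonzero_first_weight)
      fix f y u
      assume f: "g1_basis scale br n f N" "y = x + u" "u \<in> N"
      then have "y \<notin> N" using shift_notin[of "1 / \<alpha>" u] False by (simp add: x_def)
      note ext = extend[OF f(1) this]
      assume families: "(\<exists>a. x_brackets scale br n f y (R2c n a) (\<lambda>k. 0))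
        \<or> (\<exists>\<delta>. x_brackets scale br n f y (R3c n) (\<lambda>k. if k = n - 1 then \<delta> else 0))
        \<or> (\<exists>\<delta>. x_brackets scale br n f y (R4c n) (\<lambda>k. if k = n then \<delta> else 0))
        \<or> (\<exists>a. x_brackets scale br n f y (R5c n a) (\<lambda>k. 0))
        \<or> (\<exists>a2. x_brackets scale br n f y (R6c n a2) (\<lambda>k. 0))
        \<or> (\<exists>b2. b2 \<notin> {4 - of_nat n, 3 - of_nat n, (4 - of_nat n) / 2, (5 - of_nat n) / 2, 1} \<and>
             x_brackets scale br n f y (R7c n b2) (\<lambda>k. 0))"
      show ?thesis
        by (intro exI[of _ f] exI[of _ y] conjI) (rule f(1) ext disjI2[OF families])+
    qed
  qed
qed

end
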